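(* For every constants $\varepsilon>0$ and $p\in\mathbb{N}$, there exists a deterministic algorithm for maximizing a monotone submodular function $f:2^{\mathcal{N}}\to\mathbb{R}_+$ subject to $p$ packing constraints, i.e., for $\max\{f(S):S\subseteq\mathcal{N},\ \mathbf{P}\mathbf{1}_S\leq\mathbf{1}_p\}$ with $\mathbf{P}\in\mathbb{R}_+^{p\times n}$, that runs in time $O(n^{\mathrm{poly}(1/\varepsilon)})$ and achieves an approximation ratio of $\frac1e-\varepsilon$ (i.e., outputs a feasible $S$ with $f(S)\geq(\frac1e-\varepsilon)f(O)$ for an optimal solution $O$).
   Context: $\mathcal{N}=\{1,\dots,n\}$ is the ground set, $f$ is given by a value oracle, $\mathbf{1}_S$ is the indicator vector of $S$ and $\mathbf{1}_p$ the all-ones vector in $\mathbb{R}^p$. *)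

theory Defs
  imports Complex_Main
    "HOL-Library.Indicator_Function"
    "HOL-Library.Landau_Symbols"
    "HOL-Computational_Algebra.Polynomial"
begin

section \<open>Monotone submodular maximization under packing constraints\<close>

definition nonneg_on :: "'a set \<Rightarrow> ('a set \<Rightarrow> real) \<Rightarrow> bool" where
  "nonneg_on N f \<longleftrightarrow> (\<forall>A\<subseteq>N. 0 \<le> f A)"

definition monotone_set_fun :: "'a set \<Rightarrow> ('a set \<Rightarrow> real) \<Rightarrow> bool" where
  "monotone_set_fun N f \<longleftrightarrow> (\<forall>A B. A \<subseteq> B \<and> B \<subseteq> N \<longrightarrow> f A \<le> f B)"

definition submodular :: "'a set \<Rightarrow> ('a set \<Rightarrow> real) \<Rightarrow> bool" where
  "submodular N f \<longleftrightarrow> (\<forall>A\<subseteq>N. \<forall>B\<subseteq>N. f (A \<union> B) + f (A \<inter> B) \<le> f A + f B)"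

definition nonneg_matrix :: "nat \<Rightarrow> nat \<Rightarrow> (nat \<Rightarrow> nat \<Rightarrow> real) \<Rightarrow> bool" where
  "nonneg_matrix p n P \<longleftrightarrow> (\<forall>i\<in>{1..p}. \<forall>j\<in>{1..n}. 0 \<le> P i j)"

definition packing_feasible ::
    "nat \<Rightarrow> nat \<Rightarrow> (nat \<Rightarrow> nat \<Rightarrow> real) \<Rightarrow> nat set \<Rightarrow> bool" where
  "packing_feasible p n P S \<longleftrightarrow>
     S \<subseteq> {1..n} \<and> (\<forall>i\<in>{1..p}. (\<Sum>j=1..n. P i j * indicator S j) \<le> 1)"

definition packing_optimal ::
    "nat \<Rightarrow> nat \<Rightarrow> (nat \<Rightarrow> nat \<Rightarrow> real) \<Rightarrow> (nat set \<Rightarrow> real) \<Rightarrow> nat set \<Rightarrow> bool" where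
  "packing_optimal p n P f S \<longleftrightarrow>
     packing_feasible p n P S \<and> (\<forall>S'. packing_feasible p n P S' \<longrightarrow> f S' \<le> f S)"

section \<open>Deterministic algorithms with a value oracle\<close>

text \<open>
  Algorithms are programs of a structured random access machine over the naturals and the reals.
  The memory consists of arrays of naturals and arrays of reals. The array name (first argument)
  is fixed by the program, the index is computed at run time, so every program uses a fixed finite
  number of arrays; a scalar variable is an array used only at index \<open>0\<close>. Every operation,
  including a value query, takes one step. To keep this unit-cost measure meaningful,
  naturals (which serve as counters and addresses) can only be added and subtracted,
  there is no rounding from reals to naturals, and real constants in programs are rational, so that
  no infinite amount of information can be hidden in a program.
\<close>

type_synonym memory = "(nat \<Rightarrow> nat \<Rightarrow> nat) \<times> (nat \<Rightarrow> nat \<Rightarrow> real)"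

datatype nexp =
    NConst nat
  | NCell nat nexp
  | NAdd nexp nexp
  | NSub nexp nexp

text \<open>\<open>Query a\<close> is the oracle call: it evaluates the objective function on the set whose
  indicator vector is stored at indices \<open>1, \<dots>, n\<close> of the array \<open>a\<close> of naturals.\<close>

datatype rexp =
    RConst rat
  | RCell nat nexp
  | RAdd rexp rexp
  | RSub rexp rexp
  | RMul rexp rexp
  | RDiv rexp rexp
  | Query nat

datatype bexp =
    NLe nexp nexp
  | RLe rexp rexp
  | BNot bexp
  | BAnd bexp bexp

datatype com =
    Skip
  | NAssign nat nexp nexp
  | RAssign nat nexp rexp
  | Seq com com
  | Cond bexp com com
  | While bexp com

definition stored_set :: "nat \<Rightarrow> memory \<Rightarrow> nat \<Rightarrow> nat set" where
  "stored_set n s a = {j \<in> {1..n}. fst s a j \<noteq> 0}"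

fun nval :: "memory \<Rightarrow> nexp \<Rightarrow> nat" where
  "nval s (NConst k) = k"
| "nval s (NCell a e) = fst s a (nval s e)"
| "nval s (NAdd e1 e2) = nval s e1 + nval s e2"
| "nval s (NSub e1 e2) = nval s e1 - nval s e2"

fun rval :: "(nat set \<Rightarrow> real) \<Rightarrow> nat \<Rightarrow> memory \<Rightarrow> rexp \<Rightarrow> real" where
  "rval f n s (RConst r) = of_rat r"
| "rval f n s (RCell a e) = snd s a (nval s e)"
| "rval f n s (RAdd e1 e2) = rval f n s e1 + rval f n s e2"
| "rval f n s (RSub e1 e2) = rval f n s e1 - rval f n s e2"
| "rval f n s (RMul e1 e2) = rval f n s e1 * rval f n s e2"
| "rval f n s (RDiv e1 e2) = rval f n s e1 / rval f n s e2"
| "rval f n s (Query a) = f (stored_set n s a)"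

fun bval :: "(nat set \<Rightarrow> real) \<Rightarrow> nat \<Rightarrow> memory \<Rightarrow> bexp \<Rightarrow> bool" where
  "bval f n s (NLe e1 e2) \<longleftrightarrow> nval s e1 \<le> nval s e2"
| "bval f n s (RLe e1 e2) \<longleftrightarrow> rval f n s e1 \<le> rval f n s e2"
| "bval f n s (BNot b) \<longleftrightarrow> \<not> bval f n s b"
| "bval f n s (BAnd b1 b2) \<longleftrightarrow> bval f n s b1 \<and> bval f n s b2"

fun ntime :: "nexp \<Rightarrow> nat" where
  "ntime (NConst k) = 1"
| "ntime (NCell a e) = 1 + ntime e"
| "ntime (NAdd e1 e2) = 1 + ntime e1 + ntime e2"
| "ntime (NSub e1 e2) = 1 + ntime e1 + ntime e2"

fun rtime :: "rexp \<Rightarrow> nat" where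
  "rtime (RConst r) = 1"
| "rtime (RCell a e) = 1 + ntime e"
| "rtime (RAdd e1 e2) = 1 + rtime e1 + rtime e2"
| "rtime (RSub e1 e2) = 1 + rtime e1 + rtime e2"
| "rtime (RMul e1 e2) = 1 + rtime e1 + rtime e2"
| "rtime (RDiv e1 e2) = 1 + rtime e1 + rtime e2"
| "rtime (Query a) = 1"

fun btime :: "bexp \<Rightarrow> nat" where
  "btime (NLe e1 e2) = 1 + ntime e1 + ntime e2"
| "btime (RLe e1 e2) = 1 + rtime e1 + rtime e2"
| "btime (BNot b) = 1 + btime b"
| "btime (BAnd b1 b2) = 1 + btime b1 + btime b2"

definition nwrite :: "nat \<Rightarrow> nat \<Rightarrow> nat \<Rightarrow> memory \<Rightarrow> memory" where
  "nwrite a k v s = ((fst s)(a := (fst s a)(k := v)), snd s)"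

definition rwrite :: "nat \<Rightarrow> nat \<Rightarrow> real \<Rightarrow> memory \<Rightarrow> memory" where
  "rwrite a k v s = (fst s, (snd s)(a := (snd s a)(k := v)))"

text \<open>\<open>exec f n c s t s'\<close>: with value oracle \<open>f\<close> on the ground set \<open>{1..n}\<close>, the program
  \<open>c\<close> started in memory \<open>s\<close> halts after \<open>t\<close> steps in memory \<open>s'\<close>.\<close>

inductive exec ::
    "(nat set \<Rightarrow> real) \<Rightarrow> nat \<Rightarrow> com \<Rightarrow> memory \<Rightarrow> nat \<Rightarrow> memory \<Rightarrow> bool"
  for f :: "nat set \<Rightarrow> real" and n :: nat where
  Skip: "exec f n Skip s 1 s"
| NAssign: "exec f n (NAssign a i e) s (1 + ntime i + ntime e)
              (nwrite a (nval s i) (nval s e) s)"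
| RAssign: "exec f n (RAssign a i e) s (1 + ntime i + rtime e)
              (rwrite a (nval s i) (rval f n s e) s)"
| Seq: "\<lbrakk>exec f n c1 s t1 s1; exec f n c2 s1 t2 s2\<rbrakk>
          \<Longrightarrow> exec f n (Seq c1 c2) s (t1 + t2) s2"
| CondTrue: "\<lbrakk>bval f n s b; exec f n c1 s t s'\<rbrakk>
          \<Longrightarrow> exec f n (Cond b c1 c2) s (1 + btime b + t) s'"
| CondFalse: "\<lbrakk>\<not> bval f n s b; exec f n c2 s t s'\<rbrakk>
          \<Longrightarrow> exec f n (Cond b c1 c2) s (1 + btime b + t) s'"
| WhileFalse: "\<not> bval f n s b \<Longrightarrow> exec f n (While b c) s (1 + btime b) s"
| WhileTrue: "\<lbrakk>bval f n s b; exec f n c s t1 s1; exec f n (While b c) s1 t2 s2\<rbrakk>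
          \<Longrightarrow> exec f n (While b c) s (1 + btime b + t1 + t2) s2"

inductive_cases exec_SkipE: "exec f n Skip s t s'"
inductive_cases exec_NAssignE: "exec f n (NAssign a i e) s t s'"
inductive_cases exec_RAssignE: "exec f n (RAssign a i e) s t s'"
inductive_cases exec_SeqE: "exec f n (Seq c1 c2) s t s'"
inductive_cases exec_CondE: "exec f n (Cond b c1 c2) s t s'"
inductive_cases exec_WhileE: "exec f n (While b c) s t s'"

lemma exec_deterministic:
  "exec f n c s t s' \<Longrightarrow> exec f n c s u s'' \<Longrightarrow> u = t \<and> s'' = s'"
proof (induction arbitrary: u s'' rule: exec.induct)
  case (Skip s)
  then show ?case by (rule exec_SkipE) simp
next
  case (NAssign a i e s)
  then show ?case by (rule exec_NAssignE) simp
next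
  case (RAssign a i e s)
  then show ?case by (rule exec_RAssignE) simp
next
  case (Seq c1 s t1 s1 c2 t2 s2)
  from Seq.prems obtain v1 v2 r where
    "u = v1 + v2" "exec f n c1 s v1 r" "exec f n c2 r v2 s''"
    by (rule exec_SeqE)
  with Seq.IH show ?case by metis
next
  case (CondTrue s b c1 t s' c2)
  from CondTrue.prems CondTrue.hyps(1) obtain v where
    "u = 1 + btime b + v" "exec f n c1 s v s''"
    by (auto elim: exec_CondE)
  with CondTrue.IH show ?case by metis
next
  case (CondFalse s b c2 t s' c1)
  from CondFalse.prems CondFalse.hyps(1) obtain v where
    "u = 1 + btime b + v" "exec f n c2 s v s''"
    by (auto elim: exec_CondE)
  with CondFalse.IH show ?case by metis
next
  case (WhileFalse s b c)
  from WhileFalse.prems show ?case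
    by (rule exec_WhileE) (use WhileFalse.hyps in simp_all)
next
  case (WhileTrue s b c t1 s1 t2 s2)
  from WhileTrue.prems WhileTrue.hyps(1) obtain v1 r v2 where
    "u = 1 + btime b + v1 + v2" "exec f n c s v1 r" "exec f n (While b c) r v2 s''"
    by (auto elim: exec_WhileE)
  with WhileTrue.IH show ?case by metis
qed

text \<open>Initially index \<open>0\<close> of the array \<open>0\<close> of naturals holds \<open>n\<close>, the array \<open>i\<close> of reals
  (\<open>1 \<le> i \<le> p\<close>) holds row \<open>i\<close> of \<open>P\<close> at indices \<open>1, \<dots>, n\<close>, and all other memory is
  zero. The output set is read off as an indicator vector from the array \<open>1\<close> of naturals.\<close>

definition initial_memory :: "nat \<Rightarrow> nat \<Rightarrow> (nat \<Rightarrow> nat \<Rightarrow> real) \<Rightarrow> memory" where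
  "initial_memory p n P =
     (\<lambda>a k. if a = 0 \<and> k = 0 then n else 0,
      \<lambda>i j. if i \<in> {1..p} \<and> j \<in> {1..n} then P i j else 0)"

definition output_set :: "nat \<Rightarrow> memory \<Rightarrow> nat set" where
  "output_set n s = stored_set n s 1"

text \<open>The single program \<open>c\<close> has to handle all \<open>n\<close>, and \<open>T n\<close> bounds its running time
  on all instances with ground set \<open>{1..n}\<close>.\<close>

definition packing_approx_algorithm ::
    "nat \<Rightarrow> real \<Rightarrow> (nat \<Rightarrow> nat) \<Rightarrow> com \<Rightarrow> bool" where
  "packing_approx_algorithm p \<alpha> T c \<longleftrightarrow>
     (\<forall>n f P. nonneg_on {1..n} f \<and> monotone_set_fun {1..n} f \<and> submodular {1..n} f
          \<and> nonneg_matrix p n P \<longrightarrow>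
        (\<exists>t s. exec f n c (initial_memory p n P) t s \<and> t \<le> T n
          \<and> packing_feasible p n P (output_set n s)
          \<and> (\<forall>Opt. packing_optimal p n P f Opt \<longrightarrow> f (output_set n s) \<ge> \<alpha> * f Opt)))"

end

theory Submission
  imports Defs
begin

text \<open>
  A ratio of \<open>7/16 > 1/e\<close> is reached with an exponent that depends on \<open>p\<close> only.
  Some set \<open>A\<close> of at most \<open>512 (p + 1)\<^sup>2\<close> items of an optimal solution is guessed such that all other
  items of the solution have small marginal value. Items that use more than a \<open>1 / (64 (p + 1))\<close>
  fraction of the remaining capacity \<open>slack A i\<close> of some constraint are discarded; the solution
  contains few of them, so this costs at most an eighth of its value. On the remaining small items a
  greedy algorithm with multiplicative weights is run: constraint \<open>i\<close> has weight
  \<open>w i = (\<Prod>k\<in>S - A. 1 + \<eta> P i k / slack A i)\<close> with \<open>\<eta> = 8 (p + 1)\<close>, and the item with the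
  best ratio of marginal gain to weighted size is added to \<open>S\<close>. For every competitor \<open>T\<close> the
  potential \<open>(f T - f S) ^ \<eta> * (\<Sum>i. w i)\<close> does not increase (by Bernoulli's inequality). When the best
  item does not fit, some weight is about \<open>exp (7 \<eta> / 8) > p * 2 ^ \<eta>\<close>, which forces \<open>f T \<le> 2 * f S\<close>.
\<close>

section \<open>Programs with statically bounded cost\<close>

text \<open>A loop gets \<open>n + 2\<close> units because the loops below run over \<open>{0..n}\<close> or \<open>{1..n}\<close> and test their
  condition once more.\<close>

fun cost :: "nat \<Rightarrow> com \<Rightarrow> nat" where
  "cost n Skip = 1"
| "cost n (NAssign a i e) = 1 + ntime i + ntime e"
| "cost n (RAssign a i e) = 1 + ntime i + rtime e"
| "cost n (Seq c d) = cost n c + cost n d"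
| "cost n (Cond b c d) = 1 + btime b + cost n c + cost n d"
| "cost n (While b c) = (n + 2) * (1 + btime b + cost n c)"

fun loop_depth :: "com \<Rightarrow> nat" where
  "loop_depth (Seq c d) = max (loop_depth c) (loop_depth d)"
| "loop_depth (Cond b c d) = max (loop_depth c) (loop_depth d)"
| "loop_depth (While b c) = Suc (loop_depth c)"
| "loop_depth _ = 0"

text \<open>Each \<open>While\<close> multiplies the cost by n + 2 and all other constructs only
  add, so the exponent is the nesting depth.\<close>

lemma cost_le: "\<exists>C. \<forall>n. cost n c \<le> C * (n + 2) ^ loop_depth c"
proof (induction c)
  case (Seq c d)
  then obtain C D where CD: "\<And>n. cost n c \<le> C * (n + 2) ^ loop_depth c"
      "\<And>n. cost n d \<le> D * (n + 2) ^ loop_depth d"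
    by blast
  have "cost n (Seq c d) \<le> (C + D) * (n + 2) ^ loop_depth (Seq c d)" for n
  proof -
    have "C * (n + 2) ^ loop_depth c \<le> C * (n + 2) ^ loop_depth (Seq c d)"
      "D * (n + 2) ^ loop_depth d \<le> D * (n + 2) ^ loop_depth (Seq c d)"
      by (intro mult_left_mono power_increasing; simp)+
    then show ?thesis
      using CD[of n] unfolding cost.simps distrib_right by linarith
  qed
  then show ?case by blast
next
  case (Cond b c d)
  then obtain C D where CD: "\<And>n. cost n c \<le> C * (n + 2) ^ loop_depth c"
      "\<And>n. cost n d \<le> D * (n + 2) ^ loop_depth d"
    by blast
  have "cost n (Cond b c d) \<le> (1 + btime b + C + D) * (n + 2) ^ loop_depth (Cond b c d)" for n
  proof -
    have "(1 + btime b) * 1 \<le> (1 + btime b) * (n + 2) ^ loop_depth (Cond b c d)"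
      "C * (n + 2) ^ loop_depth c \<le> C * (n + 2) ^ loop_depth (Cond b c d)"
      "D * (n + 2) ^ loop_depth d \<le> D * (n + 2) ^ loop_depth (Cond b c d)"
      by (intro mult_left_mono power_increasing one_le_power; simp)+
    then show ?thesis
      using CD[of n] unfolding cost.simps distrib_right by linarith
  qed
  then show ?case by blast
next
  case (While b c)
  then obtain C where C: "\<And>n. cost n c \<le> C * (n + 2) ^ loop_depth c"
    by blast
  have "cost n (While b c) \<le> (1 + btime b + C) * (n + 2) ^ loop_depth (While b c)" for n
  proof -
    have "(1 + btime b) * 1 \<le> (1 + btime b) * (n + 2) ^ loop_depth c"
      by (intro mult_left_mono one_le_power) auto
    then have "1 + btime b + cost n c \<le> (1 + btime b + C) * (n + 2) ^ loop_depth c"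
      using C[of n] unfolding distrib_right by linarith
    then have "(n + 2) * (1 + btime b + cost n c) \<le> (n + 2) * ((1 + btime b + C) * (n + 2) ^ loop_depth c)"
      by (rule mult_le_mono2)
    then show ?thesis
      by (simp only: cost.simps loop_depth.simps power_Suc mult.left_commute)
  qed
  then show ?case by blast
qed (auto intro: exI[of _ "1 + ntime i + ntime e" for i e] exI[of _ "1 + ntime i + rtime e" for i e])

lemma cost_bigo: "(\<lambda>n. real (cost n c)) \<in> O(\<lambda>n. real n powr real (loop_depth c))"
proof -
  obtain C where C: "\<And>n. cost n c \<le> C * (n + 2) ^ loop_depth c"
    using cost_le by blast
  \<comment> \<open>For n \<ge> 1 the base n + 2 is at most 3 * n. The case n = 0 is left out
    because \<open>0 powr 0 = 0\<close>.\<close>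
  have "real (cost n c) \<le> (real C * 3 ^ loop_depth c) * real n powr real (loop_depth c)" if "1 \<le> n" for n
  proof -
    have "cost n c \<le> C * (3 * n) ^ loop_depth c"
      using that by (intro order_trans[OF C] mult_left_mono power_mono) auto
    then have "real (cost n c) \<le> real (C * (3 * n) ^ loop_depth c)"
      by (rule of_nat_mono)
    then show ?thesis
      using that by (simp add: powr_realpow power_mult_distrib)
  qed
  then show ?thesis
    by (intro bigoI[of _ "real C * 3 ^ loop_depth c"]) (auto simp: eventually_at_top_linorder intro!: exI[of _ 1])
qed

section \<open>Syntactic frame conditions\<close>

fun nmod :: "com \<Rightarrow> nat set" where
  "nmod (NAssign a i e) = {a}"
| "nmod (Seq c d) = nmod c \<union> nmod d"
| "nmod (Cond b c d) = nmod c \<union> nmod d"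
| "nmod (While b c) = nmod c"
| "nmod _ = {}"

fun rmod :: "com \<Rightarrow> nat set" where
  "rmod (RAssign a i e) = {a}"
| "rmod (Seq c d) = rmod c \<union> rmod d"
| "rmod (Cond b c d) = rmod c \<union> rmod d"
| "rmod (While b c) = rmod c"
| "rmod _ = {}"

definition unchanged :: "com \<Rightarrow> memory \<Rightarrow> memory \<Rightarrow> bool" where
  "unchanged c s s' \<longleftrightarrow> (\<forall>a. a \<notin> nmod c \<longrightarrow> fst s' a = fst s a) \<and> (\<forall>a. a \<notin> rmod c \<longrightarrow> snd s' a = snd s a)"

lemma fst_nwrite [simp]: "fst (nwrite a k v s) b i = (if b = a \<and> i = k then v else fst s b i)"
  and snd_nwrite [simp]: "snd (nwrite a k v s) = snd s"
  and fst_rwrite [simp]: "fst (rwrite a k x s) = fst s"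
  and snd_rwrite [simp]: "snd (rwrite a k x s) b i = (if b = a \<and> i = k then x else snd s b i)"
  by (auto simp: nwrite_def rwrite_def)

lemma nwrite_other [simp]: "b \<noteq> a \<Longrightarrow> fst (nwrite a k v s) b = fst s b"
  and rwrite_other [simp]: "b \<noteq> a \<Longrightarrow> snd (rwrite a k x s) b = snd s b"
  by (auto simp: nwrite_def rwrite_def)

lemma stored_set_nwrite_other [simp]: "b \<noteq> a \<Longrightarrow> stored_set n (nwrite a k v s) b = stored_set n s b"
  and stored_set_rwrite [simp]: "stored_set n (rwrite a k x s) b = stored_set n s b"
  by (auto simp: stored_set_def)

lemma stored_set_nwrite_1 [simp]:
  "stored_set n (nwrite a k (Suc 0) s) a = (if k \<in> {1..n} then insert k (stored_set n s a) else stored_set n s a)"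
  and stored_set_nwrite_0 [simp]: "stored_set n (nwrite a k 0 s) a = stored_set n s a - {k}"
  by (auto simp: stored_set_def)

lemma stored_set_subset: "stored_set n s a \<subseteq> {1..n}"
  by (auto simp: stored_set_def)

lemma stored_set_cong: "fst s' a = fst s a \<Longrightarrow> stored_set n s' a = stored_set n s a"
  by (simp add: stored_set_def)

lemma exec_unchanged: "exec f n c s t s' \<Longrightarrow> unchanged c s s'"
  by (induction rule: exec.induct) (auto simp: unchanged_def)

text \<open>Total correctness together with the time bound. As \<open>cost\<close> is static, the
  correctness proofs of the program never mention time; as execution is deterministic, the
  existential quantifier loses nothing.\<close>

definition runs :: "(nat set \<Rightarrow> real) \<Rightarrow> nat \<Rightarrow> com \<Rightarrow> memory \<Rightarrow> (memory \<Rightarrow> bool) \<Rightarrow> bool" where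
  "runs f n c s Q \<longleftrightarrow> (\<exists>t s'. exec f n c s t s' \<and> t \<le> cost n c \<and> Q s')"

lemma runs_Skip: "Q s \<Longrightarrow> runs f n Skip s Q"
  unfolding runs_def by (intro exI conjI, rule exec.Skip) auto

lemma runs_NAssign: "Q (nwrite a (nval s i) (nval s e) s) \<Longrightarrow> runs f n (NAssign a i e) s Q"
  unfolding runs_def by (intro exI conjI, rule exec.NAssign) auto

lemma runs_RAssign: "Q (rwrite a (nval s i) (rval f n s e) s) \<Longrightarrow> runs f n (RAssign a i e) s Q"
  unfolding runs_def by (intro exI conjI, rule exec.RAssign) auto

lemma runs_Seq: "runs f n c s (\<lambda>s'. runs f n d s' Q) \<Longrightarrow> runs f n (Seq c d) s Q"
  unfolding runs_def by (metis (no_types, lifting) exec.Seq add_mono cost.simps(4))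

lemma runs_Cond:
  assumes "bval f n s b \<Longrightarrow> runs f n c s Q" "\<not> bval f n s b \<Longrightarrow> runs f n d s Q"
  shows "runs f n (Cond b c d) s Q"
proof (cases "bval f n s b")
  case True
  then obtain t s' where "exec f n c s t s'" "t \<le> cost n c" "Q s'"
    using assms by (auto simp: runs_def)
  then show ?thesis
    using exec.CondTrue[OF True, of c t s' d] unfolding runs_def by fastforce
next
  case False
  then obtain t s' where "exec f n d s t s'" "t \<le> cost n d" "Q s'"
    using assms by (auto simp: runs_def)
  then show ?thesis
    using exec.CondFalse[OF False, of d t s' c] unfolding runs_def by fastforce
qed

text \<open>The consequence rule with the frame rule built in, so that postconditions need to
  describe only the arrays a program writes.\<close>

lemma runs_mono:
  assumes "runs f n c s Q" "\<And>s'. unchanged c s s' \<Longrightarrow> Q s' \<Longrightarrow> R s'"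
  shows "runs f n c s R"
  using assms exec_unchanged unfolding runs_def by blast

text \<open>Row \<open>i\<close> of the matrix is the array named \<open>i\<close>, and array names
  cannot be computed at run time. Loops over constraints and over guess positions are therefore
  written out; their lengths are constants of the program.\<close>

fun unroll :: "(nat \<Rightarrow> com) \<Rightarrow> nat \<Rightarrow> com" where
  "unroll c 0 = Skip"
| "unroll c (Suc k) = Seq (unroll c k) (c (Suc k))"

lemma nmod_unroll [simp]: "nmod (unroll c m) = (\<Union>k\<in>{1..m}. nmod (c k))"
  and rmod_unroll [simp]: "rmod (unroll c m) = (\<Union>k\<in>{1..m}. rmod (c k))"
  by (induction m) (auto simp: atLeastAtMostSuc_conv)

lemma runs_unroll:
  assumes "I 0 s" "\<And>k s. k < m \<Longrightarrow> I k s \<Longrightarrow> runs f n (c (Suc k)) s (I (Suc k))"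
  shows "runs f n (unroll c m) s (I m)"
  using assms
  by (induction m) (auto intro!: runs_Skip runs_Seq elim: runs_mono)

definition For :: "nat \<Rightarrow> nat \<Rightarrow> com \<Rightarrow> com" where
  "For v lo c = Seq (NAssign v (NConst 0) (NConst lo))
     (While (NLe (NCell v (NConst 0)) (NCell 0 (NConst 0)))
        (Seq c (NAssign v (NConst 0) (NAdd (NCell v (NConst 0)) (NConst 1)))))"

lemma nmod_For [simp]: "nmod (For v lo c) = insert v (nmod c)"
  and rmod_For [simp]: "rmod (For v lo c) = rmod c"
  by (auto simp: For_def)

text \<open>\<open>I k\<close> describes the memory right after the counter was set to
  \<open>k\<close>, so \<open>I (Suc n)\<close> holds on exit. The body may write neither the
  counter nor array 0, which stores the bound \<open>n\<close>.\<close>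

lemma runs_For:
  assumes "fst s 0 0 = n" "lo \<le> Suc n" "v \<noteq> 0" "v \<notin> nmod c" "0 \<notin> nmod c"
    and init: "I lo (nwrite v 0 lo s)"
    and step: "\<And>k s. lo \<le> k \<Longrightarrow> k \<le> n \<Longrightarrow> fst s v 0 = k \<Longrightarrow> I k s \<Longrightarrow>
      runs f n c s (\<lambda>s'. I (Suc k) (nwrite v 0 (Suc k) s'))"
  shows "runs f n (For v lo c) s (I (Suc n))"
proof -
  let ?b = "NLe (NCell v (NConst 0)) (NCell 0 (NConst 0))"
  let ?c = "Seq c (NAssign v (NConst 0) (NAdd (NCell v (NConst 0)) (NConst 1)))"
  have loop: "\<exists>t s'. exec f n (While ?b ?c) s t s' \<and>
      t \<le> m * (1 + btime ?b + cost n ?c) + (1 + btime ?b) \<and> I (Suc n) s'"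
    if "fst s v 0 = k" "fst s 0 0 = n" "lo \<le> k" "k + m = Suc n" "I k s" for k m s
    using that
  proof (induction m arbitrary: k s)
    case 0
    then have "exec f n (While ?b ?c) s (1 + btime ?b) s"
      by (intro exec.WhileFalse) auto
    then show ?case
      using 0 by (intro exI[of _ "1 + btime ?b"] exI[of _ s]) auto
  next
    case (Suc m)
    have "runs f n ?c s (\<lambda>s'. I (Suc k) s' \<and> fst s' v 0 = Suc k \<and> fst s' 0 0 = n)"
      using Suc.prems assms(3-5)
      by (intro runs_Seq runs_mono[OF step[of k s]] runs_NAssign) (auto simp: unchanged_def)
    then obtain t1 s1 where 1: "exec f n ?c s t1 s1" "t1 \<le> cost n ?c"
        "I (Suc k) s1" "fst s1 v 0 = Suc k" "fst s1 0 0 = n"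
      unfolding runs_def by blast
    obtain t2 s2 where 2: "exec f n (While ?b ?c) s1 t2 s2"
        "t2 \<le> m * (1 + btime ?b + cost n ?c) + (1 + btime ?b)" "I (Suc n) s2"
      using Suc.IH[of s1 "Suc k"] 1 Suc.prems by auto
    have "exec f n (While ?b ?c) s (1 + btime ?b + t1 + t2) s2"
      using Suc.prems 1 2 by (intro exec.WhileTrue) auto
    moreover have "1 + btime ?b + t1 + t2 \<le> Suc m * (1 + btime ?b + cost n ?c) + (1 + btime ?b)"
      unfolding mult_Suc using 1(2) 2(2) by linarith
    ultimately show ?case
      using 2(3) by blast
  qed
  have start: "fst (nwrite v 0 lo s) v 0 = lo" "fst (nwrite v 0 lo s) 0 0 = n"
    using assms(1,3) by auto
  have len: "lo + (Suc n - lo) = Suc n"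
    using assms(2) by simp
  have "runs f n (While ?b ?c) (nwrite v 0 lo s) (I (Suc n))"
  proof -
    obtain t s' where t: "exec f n (While ?b ?c) (nwrite v 0 lo s) t s'"
        "t \<le> (Suc n - lo) * (1 + btime ?b + cost n ?c) + (1 + btime ?b)" "I (Suc n) s'"
      using loop[OF start order_refl len init] by blast
    have "(Suc n - lo) * (1 + btime ?b + cost n ?c) \<le> Suc n * (1 + btime ?b + cost n ?c)"
      by (rule mult_le_mono1) simp
    moreover have "cost n (While ?b ?c) = Suc n * (1 + btime ?b + cost n ?c) + (1 + btime ?b + cost n ?c)"
      by (simp only: cost.simps(6)) (simp add: algebra_simps)
    ultimately have "t \<le> cost n (While ?b ?c)"
      using t(2) by linarith
    then show ?thesis
      using t unfolding runs_def by blast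
  qed
  then show ?thesis
    unfolding For_def by (intro runs_Seq runs_NAssign) simp
qed

fun sum_rexp :: "(nat \<Rightarrow> rexp) \<Rightarrow> nat \<Rightarrow> rexp" where
  "sum_rexp e 0 = RConst 0"
| "sum_rexp e (Suc k) = RAdd (sum_rexp e k) (e (Suc k))"

lemma rval_sum_rexp [simp]: "rval f n s (sum_rexp e m) = (\<Sum>i=1..m. rval f n s (e i))"
  by (induction m) auto

fun conj_bexp :: "(nat \<Rightarrow> bexp) \<Rightarrow> nat \<Rightarrow> bexp" where
  "conj_bexp b 0 = NLe (NConst 0) (NConst 0)"
| "conj_bexp b (Suc k) = BAnd (conj_bexp b k) (b (Suc k))"

lemma bval_conj_bexp [simp]: "bval f n s (conj_bexp b m) \<longleftrightarrow> (\<forall>i\<in>{1..m}. bval f n s (b i))"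
  by (induction m) (auto simp: atLeastAtMostSuc_conv)

section \<open>Greedy with multiplicative weights\<close>

lemma packing_feasible_iff:
  "packing_feasible p n P S \<longleftrightarrow> S \<subseteq> {1..n} \<and> (\<forall>i\<in>{1..p}. sum (P i) S \<le> 1)"
proof -
  have "(\<Sum>j=1..n. P i j * indicator S j) = sum (P i) S" if "S \<subseteq> {1..n}" for i
    using that by (simp add: indicator_def sum.If_cases if_distrib Int_absorb1 cong: if_cong)
  then show ?thesis
    unfolding packing_feasible_def by auto
qed

text \<open>One step of the potential argument: \<open>D\<close> is the distance
  \<open>f T - f S\<close>, \<open>d\<close> the gain and \<open>W\<close> the price of the chosen
  item, \<open>F\<close> the total weight. With \<open>x = W / F\<close> the hypothesis reads
  \<open>D * x \<le> d\<close>, hence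
  \<open>(D - d) * (1 + x) \<le> D * (1 - x) * (1 + x) \<le> D\<close>; Bernoulli's inequality
  bounds \<open>1 + m * x\<close> by \<open>(1 + x) ^ m\<close>.\<close>

lemma mult_power_diff_le:
  fixes D d W F :: real
  assumes "0 \<le> W" "0 \<le> F" "D * W \<le> d * F" "d < D" "0 \<le> d"
  shows "(D - d) ^ m * (F + m * W) \<le> D ^ m * F"
proof (cases "F = 0")
  case True
  then have "W = 0"
    using assms by (auto simp: mult_le_0_iff)
  then show ?thesis
    using True by simp
next
  case False
  then have F: "0 < F"
    using assms by simp
  define x where "x = W / F"
  have x: "0 \<le> x" "D * x \<le> d" "F + m * W = (1 + m * x) * F"
    using assms F by (auto simp: x_def field_simps)
  have "(D - d) * (1 + x) \<le> D * (1 - x) * (1 + x)"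
    using x by (intro mult_right_mono) (auto simp: algebra_simps)
  also have "\<dots> \<le> D"
    using assms by (simp add: algebra_simps)
  finally have D: "(D - d) * (1 + x) \<le> D" .
  have "(D - d) ^ m * (1 + m * x) \<le> (D - d) ^ m * (1 + x) ^ m"
    using x assms Bernoulli_inequality[of x m] by (intro mult_left_mono) auto
  also have "\<dots> \<le> D ^ m"
    unfolding power_mult_distrib[symmetric] using x assms D by (intro power_mono) auto
  finally show ?thesis
    using F by (simp add: x(3) mult.assoc[symmetric])
qed

text \<open>Factor by factor: \<open>ln (1 + z) \<ge> z - z\<^sup>2 \<ge> 7 / 8 * z\<close> for z
  between 0 and 1 / 8.\<close>

lemma exp_sum_le_prod:
  fixes z :: "'b \<Rightarrow> real"
  assumes "finite B" "\<And>k. k \<in> B \<Longrightarrow> 0 \<le> z k \<and> z k \<le> 1 / 8"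
  shows "exp (7 / 8 * sum z B) \<le> (\<Prod>k\<in>B. 1 + z k)"
proof -
  have "exp (7 / 8 * z k) \<le> 1 + z k" if "k \<in> B" for k
  proof -
    have "7 / 8 * z k \<le> z k - (z k)\<^sup>2"
      using assms(2)[OF that] mult_left_mono[of "z k" "1/8" "z k"]
      by (simp add: power2_eq_square)
    also have "\<dots> \<le> ln (1 + z k)"
      using assms(2)[OF that] by (intro ln_one_plus_pos_lower_bound) auto
    finally show ?thesis
      using assms(2)[OF that] by (metis add_pos_nonneg exp_le_cancel_iff exp_ln zero_less_one)
  qed
  then have "(\<Prod>k\<in>B. exp (7 / 8 * z k)) \<le> (\<Prod>k\<in>B. 1 + z k)"
    by (intro prod_mono) auto
  then show ?thesis
    using assms(1) by (simp add: exp_sum sum_distrib_left)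
qed

text \<open>The rate 7 is split as 28 / 5 + 7 / 5. The first part absorbs the power of two, since
  \<open>2 \<le> exp (7 / 10)\<close> and 8 * 7 / 10 = 28 / 5; the second exceeds
  \<open>p * 9 / 8\<close>.\<close>

lemma exp_dominates:
  fixes p :: nat
  shows "real p * 2 ^ (8 * (p + 1)) < 8 / 9 * exp (7 * real (p + 1))"
proof -
  have "x * 9 / 8 < 1 + 7 / 5 * (x + 1)" if "0 \<le> x" for x :: real
    using that by (simp add: field_simps)
  from this[of p] have "real p * 9 / 8 < 1 + 7 / 5 * real (p + 1)"
    by (simp add: add.commute)
  also have "\<dots> \<le> exp (7 / 5 * real (p + 1))"
    by (rule exp_ge_add_one_self)
  finally have p: "real p * 9 / 8 < exp (7 / 5 * real (p + 1))" .
  \<comment> \<open>The quadratic Taylor bound at 7 / 10, or its square at 7 / 20, falls just short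
    of 2; the fourth power at 7 / 40 suffices.\<close>
  have "(2::real) \<le> (1 + 7 / 40 + (7 / 40)\<^sup>2 / 2) ^ 4"
    by (simp add: power2_eq_square power4_eq_xxxx)
  also have "\<dots> \<le> exp (7 / 40) ^ 4"
    using exp_lower_Taylor_quadratic[of "7 / 40"] by (intro power_mono) auto
  also have "\<dots> = exp (7 / 10)"
    by (simp add: exp_of_nat_mult[symmetric])
  finally have "(2::real) \<le> exp (7 / 10)" .
  then have "(2::real) ^ (8 * (p + 1)) \<le> exp (7 / 10) ^ (8 * (p + 1))"
    by (intro power_mono) auto
  also have "\<dots> = exp (28 / 5 * real (p + 1))"
    by (simp add: exp_of_nat_mult[symmetric] algebra_simps)
  finally have "real p * 9 / 8 * 2 ^ (8 * (p + 1)) < exp (7 / 5 * real (p + 1)) * exp (28 / 5 * real (p + 1))"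
    using p by (intro mult_less_le_imp_less) auto
  also have "\<dots> = exp (7 * real (p + 1))"
    by (simp add: exp_add[symmetric] field_simps)
  finally show ?thesis
    by simp
qed

section \<open>A fixed instance: slacks, prices and the greedy invariant\<close>

locale packing_instance =
  fixes n p :: nat and f :: "nat set \<Rightarrow> real" and P :: "nat \<Rightarrow> nat \<Rightarrow> real"
  assumes nonneg: "nonneg_on {1..n} f"
    and mono: "monotone_set_fun {1..n} f"
    and submod: "submodular {1..n} f"
    and P_nonneg: "nonneg_matrix p n P"
begin

abbreviation feasible :: "nat set \<Rightarrow> bool" where
  "feasible \<equiv> packing_feasible p n P"

definition slack :: "nat set \<Rightarrow> nat \<Rightarrow> real" where
  "slack S i = 1 - sum (P i) S"

definition gain :: "nat set \<Rightarrow> nat \<Rightarrow> real" where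
  "gain S j = f (insert j S) - f S"

text \<open>In the definitions below \<open>A\<close> is the guessed set. If its slack is \<open>0\<close> in row \<open>i\<close>, then \<open>P i j = 0\<close> for
  every candidate, so the quotient \<open>P i j / slack A i = 0\<close> is the intended value.\<close>

definition candidates :: "nat set \<Rightarrow> nat set \<Rightarrow> nat set" where
  "candidates A S = {j \<in> {1..n} - S. \<forall>i\<in>{1..p}. real (64 * (p + 1)) * P i j \<le> slack A i}"

definition weight :: "nat set \<Rightarrow> nat set \<Rightarrow> nat \<Rightarrow> real" where
  "weight A S i = (\<Prod>k\<in>S - A. 1 + real (8 * (p + 1)) * (P i k / slack A i))"

definition price :: "nat set \<Rightarrow> nat set \<Rightarrow> nat \<Rightarrow> real" where
  "price A S j = (\<Sum>i=1..p. weight A S i * (P i j / slack A i))"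

text \<open>The common class of greedy sets and competitors. Smallness of the added items is
  measured by the slack of \<open>A\<close>, which stays fixed while the set grows.\<close>

definition extension :: "nat set \<Rightarrow> nat set \<Rightarrow> bool" where
  "extension A T \<longleftrightarrow> A \<subseteq> T \<and> T - A \<subseteq> candidates A A \<and> feasible T"

text \<open>The right-hand side bounds the potential at \<open>S = A\<close>, where all weights are
  empty products and \<open>f A \<ge> 0\<close>. The restriction to \<open>f S < f T\<close> keeps
  the base of the power positive.\<close>

definition greedy_state :: "nat set \<Rightarrow> nat set \<Rightarrow> bool" where
  "greedy_state A S \<longleftrightarrow> extension A S \<and>
     (\<forall>T. extension A T \<longrightarrow> f S < f T \<longrightarrow>
        (f T - f S) ^ (8 * (p + 1)) * (\<Sum>i=1..p. weight A S i) \<le> f T ^ (8 * (p + 1)) * real p)"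

text \<open>Ratios of gain to price are compared by cross-multiplication, which covers items of
  price 0 without a division.\<close>

definition best :: "nat set \<Rightarrow> nat set \<Rightarrow> nat \<Rightarrow> bool" where
  "best A S j \<longleftrightarrow> j \<in> candidates A S \<and>
     (\<forall>k\<in>candidates A S. gain S k * price A S j \<le> gain S j * price A S k)"

definition half_optimal :: "nat set \<Rightarrow> nat set \<Rightarrow> bool" where
  "half_optimal A S \<longleftrightarrow> (\<forall>T. extension A T \<longrightarrow> f T \<le> 2 * f S)"

section \<open>Monotonicity, submodularity and feasibility\<close>

lemma f_nonneg: "S \<subseteq> {1..n} \<Longrightarrow> 0 \<le> f S"
  using nonneg by (auto simp: nonneg_on_def)

lemma f_mono: "S \<subseteq> T \<Longrightarrow> T \<subseteq> {1..n} \<Longrightarrow> f S \<le> f T"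
  using mono by (auto simp: monotone_set_fun_def)

lemma P_ge_0: "i \<in> {1..p} \<Longrightarrow> j \<in> {1..n} \<Longrightarrow> 0 \<le> P i j"
  using P_nonneg by (auto simp: nonneg_matrix_def)

lemma feasible_iff: "feasible S \<longleftrightarrow> S \<subseteq> {1..n} \<and> (\<forall>i\<in>{1..p}. 0 \<le> slack S i)"
  by (simp add: packing_feasible_iff slack_def)

lemma feasible_finite: "feasible S \<Longrightarrow> finite S"
  using finite_subset[of S "{1..n}"] by (auto simp: feasible_iff)

lemma feasible_subset:
  assumes "feasible T" "S \<subseteq> T"
  shows "feasible S"
proof -
  have "sum (P i) S \<le> sum (P i) T" if "i \<in> {1..p}" for i
    using assms feasible_finite[OF assms(1)] P_ge_0[OF that]
    by (intro sum_mono2) (auto simp: feasible_iff subset_iff)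
  then show ?thesis
    using assms by (force simp: packing_feasible_iff)
qed

lemma feasible_insert_iff:
  assumes "feasible S" "j \<in> {1..n} - S"
  shows "feasible (insert j S) \<longleftrightarrow> (\<forall>i\<in>{1..p}. P i j \<le> slack S i)"
  using assms feasible_finite[OF assms(1)] by (auto simp: feasible_iff slack_def)

lemma gain_nonneg: "S \<subseteq> {1..n} \<Longrightarrow> j \<in> {1..n} \<Longrightarrow> 0 \<le> gain S j"
  using f_mono[of S "insert j S"] by (auto simp: gain_def)

text \<open>Diminishing returns. For \<open>j\<close> outside \<open>T\<close> this is the
  submodular inequality for \<open>insert j S\<close> and \<open>T\<close>; for \<open>j\<close> in
  \<open>T\<close> the left side is 0.\<close>

lemma gain_antimono:
  assumes "S \<subseteq> T" "T \<subseteq> {1..n}" "j \<in> {1..n}"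
  shows "gain T j \<le> gain S j"
proof (cases "j \<in> T")
  case True
  then show ?thesis
    using gain_nonneg[of S j] assms by (auto simp: gain_def insert_absorb)
next
  case False
  have "f (insert j S \<union> T) + f (insert j S \<inter> T) \<le> f (insert j S) + f T"
    using submod assms unfolding submodular_def by (metis insert_subset order_trans)
  moreover have "insert j S \<union> T = insert j T" "insert j S \<inter> T = S"
    using assms False by auto
  ultimately show ?thesis
    by (simp add: gain_def)
qed

lemma f_union_le:
  assumes "S \<subseteq> {1..n}" "B \<subseteq> {1..n}"
  shows "f (S \<union> B) \<le> f S + (\<Sum>k\<in>B. gain S k)"
proof -
  have "finite B"
    using assms(2) finite_subset by blast
  then show ?thesis
    using assms(2)
  proof (induction B)
    case (insert k B)
    have "f (S \<union> insert k B) = f (S \<union> B) + gain (S \<union> B) k"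
      by (simp add: gain_def)
    also have "gain (S \<union> B) k \<le> gain S k"
      using insert.prems assms by (intro gain_antimono) auto
    finally show ?case
      using insert by auto
  qed simp
qed

section \<open>Weights, prices and the quality of the best item\<close>

lemma weight_ge_1:
  assumes "extension A S" "feasible A" "i \<in> {1..p}"
  shows "1 \<le> weight A S i"
  unfolding weight_def
proof (rule prod_ge_1)
  fix k assume "k \<in> S - A"
  then have "0 \<le> P i k" "0 \<le> slack A i"
    using assms P_ge_0[of i k] by (auto simp: extension_def feasible_iff)
  then show "1 \<le> 1 + real (8 * (p + 1)) * (P i k / slack A i)"
    by simp
qed

lemma weight_insert:
  assumes "finite S" "j \<notin> S" "j \<notin> A"
  shows "weight A (insert j S) i = weight A S i * (1 + real (8 * (p + 1)) * (P i j / slack A i))"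
  using assms by (simp add: weight_def insert_Diff_if mult.commute)

lemma price_nonneg:
  assumes "extension A S" "feasible A" "j \<in> {1..n}"
  shows "0 \<le> price A S j"
  unfolding price_def
proof (intro sum_nonneg)
  fix i assume "i \<in> {1..p}"
  then show "0 \<le> weight A S i * (P i j / slack A i)"
    using weight_ge_1[OF assms(1,2), of i] P_ge_0[of i j] assms by (auto simp: feasible_iff)
qed

lemma extension_feasible: "extension A S \<Longrightarrow> feasible A"
  by (auto simp: extension_def intro: feasible_subset)

text \<open>As \<open>A \<union> B\<close> lies in the feasible set \<open>T\<close>, the items of
  \<open>B\<close> fit into the slack of \<open>A\<close> in every row. Row \<open>i\<close> thus
  contributes at most its weight.\<close>

lemma sum_price_le:
  assumes "extension A S" "extension A T" "B \<subseteq> T - A"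
  shows "(\<Sum>k\<in>B. price A S k) \<le> (\<Sum>i=1..p. weight A S i)"
proof -
  have A: "feasible A"
    using extension_feasible[OF assms(1)] .
  have fin: "finite T"
    using assms by (auto simp: extension_def feasible_finite)
  have "(\<Sum>k\<in>B. price A S k) = (\<Sum>i=1..p. weight A S i * ((\<Sum>k\<in>B. P i k) / slack A i))"
    unfolding price_def by (subst sum.swap) (simp add: sum_distrib_left sum_divide_distrib)
  also have "\<dots> \<le> (\<Sum>i=1..p. weight A S i * 1)"
  proof (intro sum_mono mult_left_mono)
    fix i assume i: "i \<in> {1..p}"
    show "0 \<le> weight A S i"
      using weight_ge_1[OF assms(1) A i] by simp
    have "sum (P i) (A \<union> B) \<le> sum (P i) T"
      using assms fin P_ge_0[OF i]
      by (intro sum_mono2) (auto simp: extension_def feasible_iff subset_iff)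
    also have "\<dots> \<le> 1"
      using assms i by (auto simp: extension_def packing_feasible_iff)
    finally have "sum (P i) B \<le> slack A i"
      using assms fin feasible_finite[OF A] finite_subset[of B T]
      by (subst (asm) sum.union_disjoint) (auto simp: slack_def)
    moreover have "0 \<le> slack A i"
      using A i by (auto simp: feasible_iff)
    \<comment> \<open>If \<open>A\<close> fills the row, the slack is 0 and the quotient is 0 by
      convention.\<close>
    ultimately show "(\<Sum>k\<in>B. P i k) / slack A i \<le> 1"
      by (auto simp: divide_le_eq_1 order_le_less)
  qed
  finally show ?thesis
    by simp
qed

text \<open>Averaging over \<open>T - S\<close>: the gains there add up to at least
  \<open>f T - f S\<close>, the prices to at most the total weight, and no item has a better ratio
  than \<open>j\<close>.\<close>

lemma best_gain:
  assumes S: "extension A S" and T: "extension A T" and j: "best A S j"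
  shows "(f T - f S) * price A S j \<le> gain S j * (\<Sum>i=1..p. weight A S i)"
proof -
  have A: "feasible A"
    using extension_feasible[OF S] .
  have sub: "S \<subseteq> {1..n}" "T \<subseteq> {1..n}" "A \<subseteq> S"
    using S T by (auto simp: extension_def feasible_iff)
  have cand: "T - S \<subseteq> candidates A S"
    using S T by (auto simp: extension_def candidates_def)
  have jn: "j \<in> {1..n}"
    using j by (auto simp: best_def candidates_def)
  have "f T \<le> f (S \<union> (T - S))"
    using sub by (intro f_mono) auto
  also have "\<dots> \<le> f S + (\<Sum>k\<in>T - S. gain S k)"
    using sub by (intro f_union_le) auto
  finally have "(f T - f S) * price A S j \<le> (\<Sum>k\<in>T - S. gain S k) * price A S j"
    using price_nonneg[OF S A jn] by (intro mult_right_mono) auto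
  also have "\<dots> = (\<Sum>k\<in>T - S. gain S k * price A S j)"
    by (simp add: sum_distrib_right)
  also have "\<dots> \<le> (\<Sum>k\<in>T - S. gain S j * price A S k)"
    using j cand by (intro sum_mono) (auto simp: best_def)
  also have "\<dots> = gain S j * (\<Sum>k\<in>T - S. price A S k)"
    by (simp add: sum_distrib_left)
  also have "\<dots> \<le> gain S j * (\<Sum>i=1..p. weight A S i)"
    using sub gain_nonneg[OF sub(1) jn]
    by (intro mult_left_mono sum_price_le[OF S T]) auto
  finally show ?thesis .
qed

section \<open>The potential during the greedy run and at its end\<close>

lemma greedy_state_init:
  assumes "feasible A"
  shows "greedy_state A A"
  unfolding greedy_state_def
proof (intro conjI allI impI)
  show "extension A A"
    using assms by (auto simp: extension_def)
  fix T assume "extension A T" "f A < f T"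
  then show "(f T - f A) ^ (8 * (p + 1)) * (\<Sum>i=1..p. weight A A i) \<le> f T ^ (8 * (p + 1)) * real p"
    using assms f_nonneg[of A]
    by (auto simp: weight_def feasible_iff intro!: mult_right_mono power_mono)
qed

text \<open>Inserting \<open>j\<close> raises the total weight by exactly \<open>8 * (p + 1)\<close>
  times its price and lowers the distance to \<open>f T\<close> by its gain. The same number is the
  exponent of the potential, so \<open>mult_power_diff_le\<close> applies with it as
  \<open>m\<close>.\<close>

lemma greedy_state_insert:
  assumes G: "greedy_state A S" and j: "best A S j" and feas: "feasible (insert j S)"
  shows "greedy_state A (insert j S)"
  unfolding greedy_state_def
proof (intro conjI allI impI)
  have S: "extension A S"
    using G by (simp add: greedy_state_def)
  have A: "feasible A"
    using extension_feasible[OF S] .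
  have jS: "j \<in> candidates A S" "j \<notin> S" "j \<notin> A" "j \<in> {1..n}" "finite S" "S \<subseteq> {1..n}"
    using j S by (auto simp: best_def candidates_def extension_def feasible_finite feasible_iff)
  show "extension A (insert j S)"
    using S feas jS by (auto simp: extension_def candidates_def)
  let ?m = "8 * (p + 1)"
  let ?F = "\<Sum>i=1..p. weight A S i"
  fix T assume T: "extension A T" and less: "f (insert j S) < f T"
  have "(\<Sum>i=1..p. weight A (insert j S) i) = ?F + real ?m * price A S j"
    unfolding price_def sum_distrib_left sum.distrib[symmetric]
    by (intro sum.cong refl) (simp add: weight_insert jS algebra_simps add_divide_distrib)
  moreover have "f T - f (insert j S) = (f T - f S) - gain S j"
    by (simp add: gain_def)
  moreover have "0 \<le> ?F"
    using weight_ge_1[OF S A] by (intro sum_nonneg) (meson order_trans zero_le_one)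
  moreover have "gain S j < f T - f S" "0 \<le> gain S j"
    using less gain_nonneg[OF jS(6,4)] by (auto simp: gain_def)
  ultimately have "(f T - f (insert j S)) ^ ?m * (\<Sum>i=1..p. weight A (insert j S) i)
      \<le> (f T - f S) ^ ?m * ?F"
    using mult_power_diff_le[OF price_nonneg[OF S A jS(4)] _ best_gain[OF S T j], of ?m]
    by (simp only:)
  also have "\<dots> \<le> f T ^ ?m * real p"
    using G T less gain_nonneg[OF jS(6,4)] by (auto simp: greedy_state_def gain_def)
  finally show "(f T - f (insert j S)) ^ ?m * (\<Sum>i=1..p. weight A (insert j S) i) \<le> f T ^ ?m * real p" .
qed

text \<open>In a row that \<open>j\<close> violates, the items of \<open>S - A\<close> and
  \<open>j\<close> together exceed the slack of \<open>A\<close>. The increments \<open>z\<close>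
  then sum to at least \<open>8 * (p + 1)\<close>, and the product of the factors is at least
  \<open>exp (7 * (p + 1))\<close>. Taking out the factor of \<open>j\<close>, at most 9 / 8, leaves
  the weight of the row.\<close>

lemma weight_ge_of_infeasible:
  assumes S: "extension A S" and j: "j \<in> candidates A S" and infeas: "\<not> feasible (insert j S)"
  shows "\<exists>i\<in>{1..p}. 8 / 9 * exp (7 * real (p + 1)) \<le> weight A S i"
proof -
  have A: "feasible A"
    using extension_feasible[OF S] .
  have jS: "j \<notin> S" "j \<notin> A" "j \<in> {1..n}" "finite S" "A \<subseteq> S"
    using j S by (auto simp: candidates_def extension_def feasible_finite feasible_iff)
  obtain i where i: "i \<in> {1..p}" "slack S i < P i j"
    using S infeas feasible_insert_iff[of S j] jS by (auto simp: extension_def not_le)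
  define B where "B = insert j (S - A)"
  define c where "c = slack A i"
  define z where "z = (\<lambda>k. real (8 * (p + 1)) * (P i k / c))"
  have B: "0 \<le> P i k" "real (64 * (p + 1)) * P i k \<le> c" if "k \<in> B" for k
    using that S j i P_ge_0[of i k] by (auto simp: B_def c_def candidates_def extension_def)
  have fin: "finite B"
    using jS by (simp add: B_def)
  have "sum (P i) S = sum (P i) A + sum (P i) (S - A)"
    using jS by (metis add.commute sum.subset_diff)
  then have sumB: "c < sum (P i) B"
    using i jS by (simp add: B_def c_def slack_def)
  have "0 \<le> c"
    using A i by (auto simp: c_def feasible_iff)
  \<comment> \<open>With slack 0 all items of \<open>B\<close> would have size 0 in this row and
    could not overflow it.\<close>
  moreover have "c \<noteq> 0"
  proof
    assume "c = 0"
    then have "P i k \<le> 0" if "k \<in> B" for k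
      using B(2)[OF that] by (simp add: mult_le_0_iff)
    then show False
      using sumB \<open>c = 0\<close> sum_nonpos[of B "P i"] by auto
  qed
  ultimately have c: "0 < c"
    by simp
  \<comment> \<open>The constants match here: a size of at most \<open>c / (64 * (p + 1))\<close> at
    rate \<open>8 * (p + 1)\<close> gives 1 / 8.\<close>
  have z: "0 \<le> z k \<and> z k \<le> 1 / 8" if "k \<in> B" for k
    using B[OF that] c by (auto simp: z_def field_simps)
  have "sum z B = real (8 * (p + 1)) * (sum (P i) B / c)"
    by (simp add: z_def sum_distrib_left sum_divide_distrib)
  moreover have "1 \<le> sum (P i) B / c"
    using sumB c by simp
  ultimately have "8 * real (p + 1) \<le> sum z B"
    using mult_left_mono[of 1 "sum (P i) B / c" "real (8 * (p + 1))"] by simp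
  then have "exp (7 * real (p + 1)) \<le> exp (7 / 8 * sum z B)"
    by simp
  also have "\<dots> \<le> (\<Prod>k\<in>B. 1 + z k)"
    using exp_sum_le_prod[OF fin z] .
  also have "\<dots> = weight A S i * (1 + z j)"
    using jS by (simp add: B_def weight_def z_def c_def mult.commute)
  also have "\<dots> \<le> weight A S i * (9 / 8)"
    using z[of j] weight_ge_1[OF S A i(1)] by (intro mult_left_mono) (auto simp: B_def)
  finally show ?thesis
    using i by (intro bexI[of _ i]) auto
qed

text \<open>Otherwise some \<open>T\<close> has \<open>f T - f S > f T / 2\<close>. One row has
  weight at least \<open>8 / 9 * exp (7 * (p + 1))\<close>, and the invariant would force this
  number below \<open>p * 2 ^ (8 * (p + 1))\<close>, against \<open>exp_dominates\<close>.\<close>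

lemma half_optimal_of_infeasible:
  assumes G: "greedy_state A S" and j: "best A S j" and infeas: "\<not> feasible (insert j S)"
  shows "half_optimal A S"
  unfolding half_optimal_def
proof (intro allI impI, rule ccontr)
  let ?m = "8 * (p + 1)"
  have S: "extension A S"
    using G by (simp add: greedy_state_def)
  have fS: "0 \<le> f S"
    using S by (intro f_nonneg) (auto simp: extension_def feasible_iff)
  fix T assume T: "extension A T" and "\<not> f T \<le> 2 * f S"
  then have half: "0 < f T" "f T / 2 < f T - f S" "f S < f T"
    using fS by auto
  obtain i where i: "i \<in> {1..p}" "8 / 9 * exp (7 * real (p + 1)) \<le> weight A S i"
    using weight_ge_of_infeasible[OF S _ infeas] j by (auto simp: best_def)
  have "(f T / 2) ^ ?m * (8 / 9 * exp (7 * real (p + 1))) \<le> (f T - f S) ^ ?m * (\<Sum>i=1..p. weight A S i)"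
  proof (rule mult_mono)
    have "weight A S i \<le> (\<Sum>i=1..p. weight A S i)"
      using i weight_ge_1[OF S extension_feasible[OF S]]
      by (intro member_le_sum) (auto intro: order_trans[OF zero_le_one])
    then show "8 / 9 * exp (7 * real (p + 1)) \<le> (\<Sum>i=1..p. weight A S i)"
      using i by simp
  qed (use half in \<open>auto intro!: power_mono\<close>)
  also have "\<dots> \<le> f T ^ ?m * real p"
    using G T half by (auto simp: greedy_state_def)
  finally have "f T ^ ?m * (8 / 9 * exp (7 * real (p + 1))) \<le> f T ^ ?m * (real p * 2 ^ ?m)"
    by (simp add: power_divide field_simps)
  then have "8 / 9 * exp (7 * real (p + 1)) \<le> real p * 2 ^ ?m"
    using half by (metis mult_le_cancel_left_pos zero_less_power)
  then show False
    using exp_dominates[of p] by linarith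
qed

lemma half_optimal_of_no_candidates:
  assumes "extension A S" "candidates A S = {}"
  shows "half_optimal A S"
  unfolding half_optimal_def
proof (intro allI impI)
  fix T assume T: "extension A T"
  \<comment> \<open>The smallness test refers to \<open>A\<close> only, so the items of
    \<open>T - S\<close> are still candidates.\<close>
  have "T - S \<subseteq> candidates A S"
    using T assms(1) by (auto simp: extension_def candidates_def)
  then have "T \<subseteq> S"
    using assms(2) by blast
  then have "f T \<le> f S" "0 \<le> f S"
    using assms by (auto simp: extension_def feasible_iff intro!: f_mono f_nonneg)
  then show "f T \<le> 2 * f S"
    by simp
qed

lemma half_optimal_mono:
  assumes "half_optimal A S" "S \<subseteq> S'" "S' \<subseteq> {1..n}"
  shows "half_optimal A S'"
  using assms f_mono[of S S'] by (fastforce simp: half_optimal_def)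

text \<open>\<open>A\<close> is a largest subset of \<open>Opt\<close> whose value is at least \<open>f Opt / m\<close> per item.\<close>

lemma exists_guess:
  assumes O: "feasible Opt" and m: "0 < m"
  shows "\<exists>A\<subseteq>Opt. card A \<le> m \<and> (\<forall>j\<in>Opt - A. gain A j \<le> f Opt / m)"
proof (cases "f Opt = 0")
  case True
  have "gain {} j \<le> 0" if "j \<in> Opt" for j
    using that O True f_mono[of "{j}" Opt] f_nonneg[of "{}"]
    by (auto simp: gain_def feasible_iff)
  then show ?thesis
    using True by (intro exI[of _ "{}"]) auto
next
  case False
  have sub: "Opt \<subseteq> {1..n}" and fin: "finite Opt"
    using O by (auto simp: feasible_iff feasible_finite)
  have pos: "0 < f Opt"
    using False f_nonneg[OF sub] by simp
  let ?Q = "\<lambda>A. A \<subseteq> Opt \<and> card A * (f Opt / m) \<le> f A"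
  have "\<exists>A. ?Q A \<and> (\<forall>B. ?Q B \<longrightarrow> card B \<le> card A)"
  proof (rule ex_has_greatest_nat)
    show "?Q {}"
      using f_nonneg[of "{}"] by simp
    show "\<forall>A. ?Q A \<longrightarrow> card A < Suc (card Opt)"
      using fin by (auto simp: less_Suc_eq_le intro: card_mono)
  qed
  then obtain A where A: "?Q A" and max: "\<And>B. ?Q B \<Longrightarrow> card B \<le> card A"
    by blast
  have finA: "finite A"
    using A fin finite_subset by blast
  have "card A * (f Opt / m) \<le> f Opt"
    using A f_mono[OF _ sub] by (meson order_trans)
  then have "card A \<le> m"
    using pos m by (simp add: field_simps)
  moreover have "gain A j \<le> f Opt / m" if j: "j \<in> Opt - A" for j
  proof (rule ccontr)
    assume "\<not> gain A j \<le> f Opt / m"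
    then have "card A * (f Opt / m) + f Opt / m \<le> f (insert j A)"
      using A by (simp add: gain_def)
    then have "?Q (insert j A)"
      using A j finA by (simp add: ring_distribs add_divide_distrib add.commute)
    then show False
      using max[of "insert j A"] j finA by auto
  qed
  ultimately show ?thesis
    using A by blast
qed

text \<open>\<open>T\<close> is \<open>A\<close> plus the small items of \<open>Opt\<close>. Each
  row has at most \<open>64 * (p + 1)\<close> big items, so at most \<open>64 * (p + 1) ^ 2\<close>
  items are dropped, an eighth of \<open>?m\<close>. Each adds at most \<open>f Opt / ?m\<close>, so
  at most \<open>f Opt / 8\<close> is lost.\<close>

lemma exists_extension:
  assumes O: "feasible Opt"
  shows "\<exists>A T. A \<subseteq> {1..n} \<and> card A \<le> 512 * (p + 1) ^ 2 \<and> extension A T \<and> 7 / 8 * f Opt \<le> f T"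
proof -
  let ?m = "512 * (p + 1) ^ 2"
  obtain A where A: "A \<subseteq> Opt" "card A \<le> ?m" "\<And>j. j \<in> Opt - A \<Longrightarrow> gain A j \<le> f Opt / ?m"
    using exists_guess[OF O, of ?m] by auto
  define T where "T = A \<union> (Opt \<inter> candidates A A)"
  define big where "big = (\<lambda>i. {j \<in> Opt - A. slack A i < real (64 * (p + 1)) * P i j})"
  have sub: "Opt \<subseteq> {1..n}" and fin: "finite Opt"
    using O by (auto simp: feasible_iff feasible_finite)
  have "T \<subseteq> Opt"
    using A by (auto simp: T_def)
  then have T: "extension A T"
    using O by (auto simp: extension_def T_def intro: feasible_subset)
  have card_big: "card (big i) \<le> 64 * (p + 1)" if i: "i \<in> {1..p}" for i
  proof (cases "big i = {}")
    case False
    have finb: "finite (big i)"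
      using fin by (simp add: big_def)
    \<comment> \<open>Big items have more than the given fraction of the slack each, but fit into it
      together. Strictness also excludes slack 0.\<close>
    have "card (big i) * slack A i = (\<Sum>j\<in>big i. slack A i)"
      by simp
    also have "\<dots> < (\<Sum>j\<in>big i. real (64 * (p + 1)) * P i j)"
      using False finb by (intro sum_strict_mono) (auto simp: big_def)
    also have "\<dots> = real (64 * (p + 1)) * (\<Sum>j\<in>big i. P i j)"
      by (simp add: sum_distrib_left)
    also have "\<dots> \<le> real (64 * (p + 1)) * (\<Sum>j\<in>Opt - A. P i j)"
      using fin sub P_ge_0[OF i]
      by (intro mult_left_mono sum_mono2) (auto simp: big_def subset_iff)
    also have "(\<Sum>j\<in>Opt - A. P i j) \<le> slack A i"
      using bspec[OF conjunct2[OF O[unfolded packing_feasible_iff]] i] sum.subset_diff[OF A(1) fin, of "P i"]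
      by (simp add: slack_def)
    finally have "card (big i) * slack A i < real (64 * (p + 1)) * slack A i"
      by simp
    moreover have "0 \<le> slack A i"
      using feasible_subset[OF O A(1)] i by (auto simp: feasible_iff)
    ultimately have "real (card (big i)) < real (64 * (p + 1))"
      by (simp add: mult_less_cancel_right)
    then show ?thesis
      by linarith
  qed simp
  have "Opt - T \<subseteq> (\<Union>i\<in>{1..p}. big i)"
    using sub by (auto simp: T_def candidates_def big_def not_le)
  then have "card (Opt - T) \<le> card (\<Union>i\<in>{1..p}. big i)"
    using fin by (intro card_mono) (auto simp: big_def)
  also have "\<dots> \<le> (\<Sum>i\<in>{1..p}. card (big i))"
    by (intro card_UN_le) auto
  also have "\<dots> \<le> (\<Sum>i\<in>{1..p}. 64 * (p + 1))"
    using card_big by (intro sum_mono) auto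
  also have "\<dots> \<le> 64 * (p + 1) ^ 2"
    by (simp add: power2_eq_square algebra_simps)
  finally have "real (card (Opt - T)) \<le> real (64 * (p + 1) ^ 2)"
    by (rule of_nat_mono)
  then have card: "real (card (Opt - T)) \<le> ?m / 8"
    by simp
  have "f Opt \<le> f (T \<union> (Opt - T))"
    using sub \<open>T \<subseteq> Opt\<close> by (intro f_mono) auto
  also have "\<dots> \<le> f T + (\<Sum>k\<in>Opt - T. gain T k)"
    using sub \<open>T \<subseteq> Opt\<close> by (intro f_union_le) auto
  also have "(\<Sum>k\<in>Opt - T. gain T k) \<le> (\<Sum>k\<in>Opt - T. f Opt / ?m)"
  proof (rule sum_mono)
    fix k assume k: "k \<in> Opt - T"
    have "gain T k \<le> gain A k"
      using k sub \<open>T \<subseteq> Opt\<close> by (intro gain_antimono) (auto simp: T_def)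
    also have "\<dots> \<le> f Opt / ?m"
      using k by (intro A(3)) (auto simp: T_def)
    finally show "gain T k \<le> f Opt / ?m" .
  qed
  also have "(\<Sum>k\<in>Opt - T. f Opt / ?m) = card (Opt - T) * (f Opt / ?m)"
    by simp
  also have "\<dots> \<le> (?m / 8) * (f Opt / ?m)"
    using f_nonneg[OF sub] by (intro mult_right_mono card) auto
  also have "\<dots> = f Opt / 8"
    by (simp add: field_simps)
  finally have "7 / 8 * f Opt \<le> f T"
    by simp
  then show ?thesis
    using A sub T by blast
qed

end

section \<open>The program\<close>

text \<open>Arrays of naturals: 2 holds the current set, 3, 4 and 5 are the item counter, the chosen item
  (0 for none) and the round counter, \<open>guess_var k\<close> holds the \<open>k\<close>-th guessed item (0 for none).
  Arrays of reals: the weights, the slacks of the guess and the slacks of the current set are in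
  \<open>p + 1\<close>, \<open>p + 2\<close> and \<open>p + 3\<close>. In array 0, cells 1 and 2 hold gain and price of the scanned item,
  cells 3 and 4 those of the chosen item.\<close>

abbreviation item :: nexp where
  "item \<equiv> NCell 3 (NConst 0)"

abbreviation chosen :: nexp where
  "chosen \<equiv> NCell 4 (NConst 0)"

abbreviation guess_var :: "nat \<Rightarrow> nat" where
  "guess_var k \<equiv> 5 + k"

abbreviation weight_cell :: "nat \<Rightarrow> nat \<Rightarrow> rexp" where
  "weight_cell p i \<equiv> RCell (p + 1) (NConst i)"

abbreviation slack_cell :: "nat \<Rightarrow> nat \<Rightarrow> rexp" where
  "slack_cell p i \<equiv> RCell (p + 2) (NConst i)"

definition compute_slack :: "nat \<Rightarrow> nat \<Rightarrow> com" where
  "compute_slack p a =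
     Seq (unroll (\<lambda>i. RAssign a (NConst i) (RConst 1)) p)
       (For 3 1 (Cond (NLe (NConst 1) (NCell 2 item))
         (unroll (\<lambda>i. RAssign a (NConst i) (RSub (RCell a (NConst i)) (RCell i item))) p)
         Skip))"

text \<open>The gain comes from two queries around a temporary insertion. Resetting the entry to 0
  restores the set because only items outside it are measured.\<close>

definition measure_item :: "nat \<Rightarrow> com" where
  "measure_item p =
     Seq (RAssign 0 (NConst 0) (Query 2))
     (Seq (NAssign 2 item (NConst 1))
     (Seq (RAssign 0 (NConst 1) (RSub (Query 2) (RCell 0 (NConst 0))))
     (Seq (NAssign 2 item (NConst 0))
          (RAssign 0 (NConst 2)
            (sum_rexp (\<lambda>i. RMul (weight_cell p i) (RDiv (RCell i item) (slack_cell p i))) p)))))"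

definition scan_item :: "nat \<Rightarrow> com" where
  "scan_item p =
     Cond (BAnd (NLe (NCell 2 item) (NConst 0))
         (conj_bexp (\<lambda>i. RLe (RMul (RConst (of_nat (64 * (p + 1)))) (RCell i item)) (slack_cell p i)) p))
       (Seq (measure_item p)
         (Cond (BAnd (NLe (NConst 1) chosen)
              (BAnd (BNot (RLe (RCell 0 (NConst 2)) (RConst 0)))
                (RLe (RMul (RCell 0 (NConst 1)) (RCell 0 (NConst 4)))
                     (RMul (RCell 0 (NConst 3)) (RCell 0 (NConst 2))))))
            Skip
            (Seq (NAssign 4 (NConst 0) item)
            (Seq (RAssign 0 (NConst 3) (RCell 0 (NConst 1)))
                 (RAssign 0 (NConst 4) (RCell 0 (NConst 2)))))))
       Skip"

text \<open>Once the best item does not fit, every further round finds the same item and leaves the set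
  unchanged, so there is no need to leave the loop over the rounds early.\<close>

definition greedy_round :: "nat \<Rightarrow> com" where
  "greedy_round p =
     Seq (compute_slack p (p + 3))
     (Seq (NAssign 4 (NConst 0) (NConst 0))
     (Seq (For 3 1 (scan_item p))
       (Cond (BAnd (NLe (NConst 1) chosen)
            (conj_bexp (\<lambda>i. RLe (RCell i chosen) (RCell (p + 3) (NConst i))) p))
          (Seq (unroll (\<lambda>i. RAssign (p + 1) (NConst i)
                 (RMul (weight_cell p i)
                    (RAdd (RConst 1) (RMul (RConst (of_nat (8 * (p + 1)))) (RDiv (RCell i chosen) (slack_cell p i)))))) p)
               (NAssign 2 chosen (NConst 1)))
          Skip)))"

text \<open>A guessed item 0 marks cell 0, which lies outside the indicator vector, so guesses of
  fewer than \<open>m\<close> items are covered. The output is only replaced by a feasible set of no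
  smaller value.\<close>

definition evaluate_guess :: "nat \<Rightarrow> nat \<Rightarrow> com" where
  "evaluate_guess p m =
     Seq (For 3 1 (NAssign 2 item (NConst 0)))
     (Seq (unroll (\<lambda>k. NAssign 2 (NCell (guess_var k) (NConst 0)) (NConst 1)) m)
     (Seq (compute_slack p (p + 2))
     (Seq (unroll (\<lambda>i. RAssign (p + 1) (NConst i) (RConst 1)) p)
       (Cond (conj_bexp (\<lambda>i. RLe (RConst 0) (slack_cell p i)) p)
          (Seq (For 5 1 (greedy_round p))
            (Cond (RLe (Query 1) (Query 2))
              (For 3 1 (NAssign 1 item (NCell 2 item)))
              Skip))
          Skip))))"

text \<open>The number of guessed items is a constant of the program, so nested loops enumerate all
  guesses. For \<open>k = m\<close> the loop depth is \<open>m + 2\<close>, two levels being those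
  of \<open>evaluate_guess\<close>.\<close>

fun enumerate_guesses :: "nat \<Rightarrow> nat \<Rightarrow> nat \<Rightarrow> com" where
  "enumerate_guesses p m 0 = evaluate_guess p m"
| "enumerate_guesses p m (Suc k) = For (guess_var (Suc k)) 0 (enumerate_guesses p m k)"

section \<open>Arrays written by the components\<close>

lemma nmod_compute_slack [simp]: "nmod (compute_slack p a) = {3}"
  by (auto simp: compute_slack_def)

lemma rmod_compute_slack: "rmod (compute_slack p a) \<subseteq> {a}"
  by (auto simp: compute_slack_def)

lemma nmod_measure_item [simp]: "nmod (measure_item p) = {2}"
  and rmod_measure_item [simp]: "rmod (measure_item p) = {0}"
  by (auto simp: measure_item_def)

lemma nmod_scan_item [simp]: "nmod (scan_item p) = {2, 4}"
  and rmod_scan_item [simp]: "rmod (scan_item p) = {0}"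
  by (auto simp: scan_item_def)

lemma nmod_greedy_round [simp]: "nmod (greedy_round p) = {2, 3, 4}"
  by (auto simp: greedy_round_def)

lemma nmod_evaluate_guess: "nmod (evaluate_guess p m) = {1, 2, 3, 4, 5}"
  by (auto simp: evaluate_guess_def)

lemma nmod_enumerate_guesses: "nmod (enumerate_guesses p m k) = {1..guess_var k}"
proof (induction k)
  case 0
  have "{1..5} = {1, 2, 3, 4, 5 :: nat}"
    by (simp add: atLeastAtMost_insertL[symmetric] numeral_eq_Suc)
  then show ?case
    by (simp add: nmod_evaluate_guess)
next
  case (Suc k)
  have "{1..guess_var (Suc k)} = insert (guess_var (Suc k)) {1..guess_var k}"
    by auto
  then show ?case
    using Suc by simp
qed

lemma output_set_nwrite [simp]: "a \<noteq> 1 \<Longrightarrow> output_set n (nwrite a k v s) = output_set n s"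
  by (simp add: output_set_def)

section \<open>Input data and slack computation\<close>

context packing_instance
begin

definition input :: "memory \<Rightarrow> bool" where
  "input s \<longleftrightarrow> fst s 0 0 = n \<and> (\<forall>i\<in>{1..p}. \<forall>j\<in>{1..n}. snd s i j = P i j)"

lemma input_nwrite [simp]: "a \<noteq> 0 \<Longrightarrow> input (nwrite a k v s) = input s"
  and input_rwrite [simp]: "a \<notin> {1..p} \<Longrightarrow> input (rwrite a k x s) = input s"
  by (auto simp: input_def)

lemma input_unchanged:
  assumes "input s" "unchanged c s s'" "0 \<notin> nmod c" "rmod c \<inter> {1..p} = {}"
  shows "input s'"
  using assms by (fastforce simp: input_def unchanged_def)

lemma runs_compute_slack:
  assumes "input s" "p < a"
  shows "runs f n (compute_slack p a) s
    (\<lambda>s'. input s' \<and> (\<forall>i\<in>{1..p}. snd s' a i = slack (stored_set n s 2) i))"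
proof -
  let ?S = "stored_set n s 2"
  define I where "I = (\<lambda>k s'. input s' \<and> fst s' 2 = fst s 2 \<and>
    (\<forall>i\<in>{1..p}. snd s' a i = slack (?S \<inter> {1..<k}) i))"
  let ?init = "unroll (\<lambda>i. RAssign a (NConst i) (RConst 1)) p"
  have init: "runs f n ?init s (\<lambda>s'. \<forall>i\<in>{1..p}. snd s' a i = 1)"
    by (rule runs_unroll[where I = "\<lambda>k s'. \<forall>i\<in>{1..k}. snd s' a i = 1"])
      (auto intro!: runs_RAssign simp: less_Suc_eq_le le_Suc_eq)
  have step: "runs f n (Cond (NLe (NConst 1) (NCell 2 item))
         (unroll (\<lambda>i. RAssign a (NConst i) (RSub (RCell a (NConst i)) (RCell i item))) p)
         Skip) s1 (\<lambda>s'. I (Suc k) (nwrite 3 0 (Suc k) s'))"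
    if k: "1 \<le> k" "k \<le> n" "fst s1 3 0 = k" "I k s1" for k s1
  proof (rule runs_Cond)
    assume "bval f n s1 (NLe (NConst 1) (NCell 2 item))"
    then have "k \<in> ?S"
      using k by (auto simp: I_def stored_set_def)
    then have ins: "?S \<inter> {1..<Suc k} = insert k (?S \<inter> {1..<k})"
      using k by (auto simp: less_Suc_eq)
    have slack_Suc: "slack (?S \<inter> {1..<Suc k}) i = slack (?S \<inter> {1..<k}) i - P i k" for i
      unfolding ins by (simp add: slack_def)
    define Q where "Q = (\<lambda>l s'. input s' \<and> fst s' = fst s1 \<and>
       (\<forall>i\<in>{1..l}. snd s' a i = slack (?S \<inter> {1..<Suc k}) i) \<and>
       (\<forall>i\<in>{l<..p}. snd s' a i = slack (?S \<inter> {1..<k}) i))"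
    have "runs f n (unroll (\<lambda>i. RAssign a (NConst i) (RSub (RCell a (NConst i)) (RCell i item))) p) s1 (Q p)"
    proof (rule runs_unroll)
      show "Q 0 s1"
        using k by (auto simp: Q_def I_def)
      fix l s2 assume l: "l < p" "Q l s2"
      then have "snd s2 (Suc l) k = P (Suc l) k" "fst s2 3 0 = k" "snd s2 a (Suc l) = slack (?S \<inter> {1..<k}) (Suc l)"
        using k by (auto simp: Q_def input_def)
      then show "runs f n (RAssign a (NConst (Suc l)) (RSub (RCell a (NConst (Suc l))) (RCell (Suc l) item))) s2 (Q (Suc l))"
        using l assms slack_Suc
        by (intro runs_RAssign) (auto simp: Q_def le_Suc_eq)
    qed
    then show "runs f n (unroll (\<lambda>i. RAssign a (NConst i) (RSub (RCell a (NConst i)) (RCell i item))) p) s1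
        (\<lambda>s'. I (Suc k) (nwrite 3 0 (Suc k) s'))"
      by (rule runs_mono) (use k in \<open>auto simp: Q_def I_def\<close>)
  next
    assume "\<not> bval f n s1 (NLe (NConst 1) (NCell 2 item))"
    then have "k \<notin> ?S"
      using k by (auto simp: I_def stored_set_def)
    then have "?S \<inter> {1..<Suc k} = ?S \<inter> {1..<k}"
      by (auto simp: less_Suc_eq)
    then show "runs f n Skip s1 (\<lambda>s'. I (Suc k) (nwrite 3 0 (Suc k) s'))"
      using k by (intro runs_Skip) (auto simp: I_def)
  qed
  have loop: "runs f n (For 3 1 (Cond (NLe (NConst 1) (NCell 2 item))
         (unroll (\<lambda>i. RAssign a (NConst i) (RSub (RCell a (NConst i)) (RCell i item))) p)
         Skip)) s1 (I (Suc n))" if "input s1" "fst s1 2 = fst s 2" "\<forall>i\<in>{1..p}. snd s1 a i = 1" for s1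
    using that by (intro runs_For step) (auto simp: I_def input_def slack_def)
  have "?S \<inter> {1..<Suc n} = ?S"
    using stored_set_subset[of n s 2] by auto
  then show ?thesis
    unfolding compute_slack_def using assms
    by (intro runs_Seq runs_mono[OF init] runs_mono[OF loop])
      (auto simp: I_def unchanged_def input_def)
qed

section \<open>Scanning for the best item, and the greedy rounds\<close>

definition greedy_memory :: "nat set \<Rightarrow> nat set \<Rightarrow> memory \<Rightarrow> bool" where
  "greedy_memory A S s \<longleftrightarrow> input s \<and> stored_set n s 2 = S \<and>
     (\<forall>i\<in>{1..p}. snd s (p + 1) i = weight A S i \<and> snd s (p + 2) i = slack A i)"

text \<open>The condition \<open>best\<close> restricted to items below \<open>k\<close>, with gain
  and price cached in \<open>g\<close> and \<open>w\<close>. For \<open>b = 0\<close> the cached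
  values are arbitrary leftovers.\<close>

definition scanned :: "nat set \<Rightarrow> nat set \<Rightarrow> nat \<Rightarrow> nat \<Rightarrow> real \<Rightarrow> real \<Rightarrow> bool" where
  "scanned A S k b g w \<longleftrightarrow>
     (if b = 0 then candidates A S \<inter> {1..<k} = {}
      else b \<in> candidates A S \<and> g = gain S b \<and> w = price A S b \<and>
        (\<forall>j\<in>candidates A S \<inter> {1..<k}. gain S j * w \<le> g * price A S j))"

lemma scanned_skip:
  assumes "scanned A S k b g w" "k \<notin> candidates A S"
  shows "scanned A S (Suc k) b g w"
proof -
  have "candidates A S \<inter> {1..<Suc k} = candidates A S \<inter> {1..<k}"
    using assms by (auto simp: less_Suc_eq)
  then show ?thesis
    using assms by (auto simp: scanned_def split: if_splits)
qed

lemma scanned_keep: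
  assumes "scanned A S k b g w" "0 < b" "gain S k * w \<le> g * price A S k"
  shows "scanned A S (Suc k) b g w"
  using assms by (auto simp: scanned_def less_Suc_eq)

text \<open>Cross-multiplied comparison is not transitive through an item whose gain and price are
  both 0. Here, either item \<open>k\<close> has price 0 and dominates outright, or strictness
  forces \<open>w > 0\<close> and \<open>w\<close> can be cancelled.\<close>

lemma scanned_replace:
  assumes S: "extension A S" and scan: "scanned A S k b g w" and k: "k \<in> candidates A S"
    and better: "b = 0 \<or> price A S k \<le> 0 \<or> g * price A S k < gain S k * w"
  shows "scanned A S (Suc k) k (gain S k) (price A S k)"
proof -
  have A: "feasible A" "S \<subseteq> {1..n}"
    using S extension_feasible[OF S] by (auto simp: extension_def feasible_iff)
  have cand: "0 \<le> gain S j" "0 \<le> price A S j" if "j \<in> candidates A S" for j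
    using that gain_nonneg[of S j] price_nonneg[OF S A(1), of j] A by (auto simp: candidates_def)
  have "gain S j * price A S k \<le> gain S k * price A S j"
    if j: "j \<in> candidates A S" "j < k" for j
  proof (cases "price A S k \<le> 0")
    case True
    then show ?thesis
      using cand[OF k] cand[OF j(1)] by simp
  next
    case False
    have jk: "j \<in> candidates A S \<inter> {1..<k}"
      using j by (auto simp: candidates_def)
    then have b: "b \<noteq> 0"
      using scan by (auto simp: scanned_def split: if_splits)
    then have bw: "g = gain S b" "w = price A S b" "b \<in> candidates A S" "gain S j * w \<le> g * price A S j"
      using scan jk by (auto simp: scanned_def)
    have less: "g * price A S k < gain S k * w"
      using better b False by simp
    moreover have "0 \<le> g * price A S k"
      using bw cand[OF bw(3)] cand[OF k] by simp
    ultimately have w: "0 < w"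
      using cand[OF bw(3)] bw(2) by (metis less_eq_real_def mult_zero_right not_less)
    have "(gain S j * price A S k) * w = (gain S j * w) * price A S k"
      by simp
    also have "\<dots> \<le> (g * price A S j) * price A S k"
      using bw(4) cand[OF k] by (intro mult_right_mono)
    also have "\<dots> = (g * price A S k) * price A S j"
      by simp
    also have "\<dots> \<le> (gain S k * w) * price A S j"
      using less cand[OF j(1)] by (intro mult_right_mono) auto
    finally have "(gain S j * price A S k) * w \<le> (gain S k * price A S j) * w"
      by (simp add: mult_ac)
    then show ?thesis
      using w by simp
  qed
  moreover have "k \<noteq> 0"
    using k by (auto simp: candidates_def)
  ultimately show ?thesis
    using k by (auto simp: scanned_def less_Suc_eq)
qed

lemma scanned_all:
  assumes "scanned A S (Suc n) b g w"
  shows "if b = 0 then candidates A S = {} else best A S b"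
proof -
  have "candidates A S \<inter> {1..<Suc n} = candidates A S"
    by (auto simp: candidates_def)
  then show ?thesis
    using assms by (auto simp: scanned_def best_def split: if_splits)
qed

lemma runs_measure_item:
  assumes mem: "greedy_memory A S s" and k: "k \<in> {1..n} - S" "fst s 3 0 = k"
  shows "runs f n (measure_item p) s (\<lambda>s'. greedy_memory A S s' \<and> snd s' 0 1 = gain S k \<and>
     snd s' 0 2 = price A S k \<and> snd s' 0 3 = snd s 0 3 \<and> snd s' 0 4 = snd s 0 4)"
proof -
  have S: "stored_set n s 2 = S" "S - {k} = S"
    using mem k by (auto simp: greedy_memory_def)
  have "(\<Sum>i=1..p. snd s (p + 1) i * (snd s i k / snd s (p + 2) i)) = price A S k"
    unfolding price_def using mem k by (intro sum.cong) (auto simp: greedy_memory_def input_def)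
  moreover have "(\<Sum>i=1..p. (if i = 0 then x i else y i)) = (\<Sum>i=1..p. y i)" for x y :: "nat \<Rightarrow> real"
    by (intro sum.cong) auto
  ultimately show ?thesis
    unfolding measure_item_def using mem k S
    by (intro runs_Seq runs_RAssign runs_NAssign) (simp add: greedy_memory_def gain_def)
qed

lemma runs_scan_item:
  assumes S: "extension A S" and mem: "greedy_memory A S s"
    and scan: "scanned A S k (fst s 4 0) (snd s 0 3) (snd s 0 4)"
    and k: "1 \<le> k" "k \<le> n" "fst s 3 0 = k"
  shows "runs f n (scan_item p) s (\<lambda>s'. greedy_memory A S s' \<and>
     scanned A S (Suc k) (fst s' 4 0) (snd s' 0 3) (snd s' 0 4))"
proof -
  let ?elig = "BAnd (NLe (NCell 2 item) (NConst 0))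
         (conj_bexp (\<lambda>i. RLe (RMul (RConst (of_nat (64 * (p + 1)))) (RCell i item)) (slack_cell p i)) p)"
  have "fst s 2 k = 0 \<longleftrightarrow> k \<notin> S"
    using mem k by (auto simp: greedy_memory_def stored_set_def)
  then have elig: "bval f n s ?elig \<longleftrightarrow> k \<in> candidates A S"
    using k mem by (auto simp: candidates_def of_rat_mult of_rat_add greedy_memory_def input_def)
  show ?thesis
    unfolding scan_item_def
  proof (rule runs_Cond, goal_cases)
    case 2
    then have "k \<notin> candidates A S"
      using elig by blast
    then show ?case
      using scanned_skip[OF scan] mem by (intro runs_Skip) auto
  next
    case 1
    then have cand: "k \<in> candidates A S"
      using elig by blast
    then have kS: "k \<in> {1..n} - S"
      by (auto simp: candidates_def)
    show ?case
    proof (intro runs_Seq runs_mono[OF runs_measure_item[OF mem kS k(3)]], goal_cases)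
      case (1 s')
      then have s': "greedy_memory A S s'" "snd s' 0 (Suc 0) = gain S k" "snd s' 0 2 = price A S k"
          "snd s' 0 3 = snd s 0 3" "snd s' 0 4 = snd s 0 4" "fst s' 4 = fst s 4" "fst s' 3 0 = k"
        using k by (auto simp: unchanged_def)
      show ?case
      proof (intro runs_Cond runs_Skip runs_Seq runs_NAssign runs_RAssign, goal_cases)
        case 1
        then show ?case
          using s' scanned_keep[OF scan] by auto
      next
        case 2
        then have "scanned A S (Suc k) k (gain S k) (price A S k)"
          using s' by (intro scanned_replace[OF S scan cand]) auto
        then show ?case
          using s' by (simp add: greedy_memory_def)
      qed
    qed
  qed
qed

text \<open>Either no candidate exists, or the best one does not fit, or it is inserted. In the
  first two cases the set is already half-optimal; in the third it grows, which measures
  progress.\<close>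

lemma runs_greedy_round:
  assumes G: "greedy_state A S" and mem: "greedy_memory A S s"
  shows "runs f n (greedy_round p) s (\<lambda>s'. \<exists>S'. greedy_memory A S' s' \<and> greedy_state A S' \<and>
     S \<subseteq> S' \<and> (half_optimal A S' \<or> card S < card S'))"
proof -
  have S: "extension A S" "feasible S"
    using G by (auto simp: greedy_state_def extension_def)
  have rmod: "Suc p \<notin> rmod (compute_slack p (p + 3))" "Suc (Suc p) \<notin> rmod (compute_slack p (p + 3))"
    using rmod_compute_slack[of p "p + 3"] by auto
  have slack: "runs f n (compute_slack p (p + 3)) s
     (\<lambda>s1. greedy_memory A S s1 \<and> (\<forall>i\<in>{1..p}. snd s1 (p + 3) i = slack S i))"
    using mem rmod
    by (intro runs_mono[OF runs_compute_slack]) (auto simp: greedy_memory_def unchanged_def stored_set_def)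
  define I where "I = (\<lambda>k s'. greedy_memory A S s' \<and> scanned A S k (fst s' 4 0) (snd s' 0 3) (snd s' 0 4))"
  have I_nwrite: "I k (nwrite 3 0 x s') = I k s'" for k x s'
    by (simp add: I_def greedy_memory_def)
  have scan: "runs f n (For 3 1 (scan_item p)) s1 (I (Suc n))"
    if s1: "greedy_memory A S s1" "fst s1 4 0 = 0" for s1
  proof (rule runs_For)
    show "I 1 (nwrite 3 0 1 s1)"
      unfolding I_nwrite using s1 by (simp add: I_def scanned_def)
    show "runs f n (scan_item p) s2 (\<lambda>s'. I (Suc k) (nwrite 3 0 (Suc k) s'))"
      if "1 \<le> k" "k \<le> n" "fst s2 3 0 = k" "I k s2" for k s2
      using that unfolding I_nwrite unfolding I_def by (intro runs_scan_item[OF S(1)]) auto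
  qed (use s1 in \<open>auto simp: greedy_memory_def input_def\<close>)
  let ?fits = "BAnd (NLe (NConst 1) chosen)
            (conj_bexp (\<lambda>i. RLe (RCell i chosen) (RCell (p + 3) (NConst i))) p)"
  let ?update = "unroll (\<lambda>i. RAssign (p + 1) (NConst i)
       (RMul (weight_cell p i)
          (RAdd (RConst 1) (RMul (RConst (of_nat (8 * (p + 1)))) (RDiv (RCell i chosen) (slack_cell p i)))))) p"
  have final: "runs f n (Cond ?fits (Seq ?update (NAssign 2 chosen (NConst 1))) Skip) s1
     (\<lambda>s'. \<exists>S'. greedy_memory A S' s' \<and> greedy_state A S' \<and>
        S \<subseteq> S' \<and> (half_optimal A S' \<or> card S < card S'))"
    if s1: "greedy_memory A S s1" "\<And>i. i \<in> {1..p} \<Longrightarrow> snd s1 (p + 3) i = slack S i"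
      and scanned: "scanned A S (Suc n) (fst s1 4 0) (snd s1 0 3) (snd s1 0 4)" for s1
  proof (cases "fst s1 4 0 = 0")
    case True
    then have "half_optimal A S"
      using scanned_all[OF scanned] half_optimal_of_no_candidates[OF S(1)] by simp
    then show ?thesis
      using True s1 G by (intro runs_Cond runs_Skip) auto
  next
    case False
    define j where "j = fst s1 4 0"
    have best: "best A S j" and j: "j \<in> {1..n} - S" "j \<notin> A"
      using scanned_all[OF scanned] False S by (auto simp: j_def best_def candidates_def extension_def)
    have fits: "bval f n s1 ?fits \<longleftrightarrow> feasible (insert j S)"
      using s1 False j unfolding feasible_insert_iff[OF S(2) j(1)]
      by (auto simp: j_def greedy_memory_def input_def)
    define Q where "Q = (\<lambda>l s'. input s' \<and> fst s' = fst s1 \<and>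
       (\<forall>i\<in>{1..p}. snd s' (p + 2) i = slack A i) \<and>
       (\<forall>i\<in>{1..l}. snd s' (p + 1) i = weight A (insert j S) i) \<and>
       (\<forall>i\<in>{l<..p}. snd s' (p + 1) i = weight A S i))"
    have update: "runs f n ?update s1 (Q p)"
    proof (rule runs_unroll)
      show "Q 0 s1"
        using s1 by (auto simp: Q_def greedy_memory_def)
      fix l s2 assume l: "l < p" "Q l s2"
      then have "snd s2 (p + 1) (Suc l) = weight A S (Suc l)" "snd s2 (p + 2) (Suc l) = slack A (Suc l)"
         "snd s2 (Suc l) j = P (Suc l) j" "fst s2 4 0 = j"
        using j by (auto simp: Q_def input_def j_def)
      then show "runs f n (RAssign (p + 1) (NConst (Suc l))
       (RMul (weight_cell p (Suc l))
          (RAdd (RConst 1) (RMul (RConst (of_nat (8 * (p + 1)))) (RDiv (RCell (Suc l) chosen) (slack_cell p (Suc l))))))) s2 (Q (Suc l))"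
        using l weight_insert[OF feasible_finite[OF S(2)], of j A "Suc l"] j
        by (intro runs_RAssign) (auto simp: Q_def le_Suc_eq of_rat_mult of_rat_add)
    qed
    show ?thesis
    proof (intro runs_Cond runs_Seq runs_mono[OF update] runs_NAssign runs_Skip)
      fix s2 assume Q: "Q p s2" and "bval f n s1 ?fits"
      then have "greedy_state A (insert j S)"
        using greedy_state_insert[OF G best] fits by blast
      moreover have "stored_set n s2 2 = S"
        using s1 Q stored_set_cong[of s2 2 s1 n] by (auto simp: Q_def greedy_memory_def)
      then have "greedy_memory A (insert j S) (nwrite 2 (nval s2 chosen) (nval s2 (NConst 1)) s2)"
        using Q j by (auto simp: Q_def greedy_memory_def j_def)
      moreover have "card S < card (insert j S)"
        using j feasible_finite[OF S(2)] by simp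
      ultimately show "\<exists>S'. greedy_memory A S' (nwrite 2 (nval s2 chosen) (nval s2 (NConst 1)) s2) \<and>
          greedy_state A S' \<and> S \<subseteq> S' \<and> (half_optimal A S' \<or> card S < card S')"
        by blast
    next
      assume "\<not> bval f n s1 ?fits"
      then show "\<exists>S'. greedy_memory A S' s1 \<and> greedy_state A S' \<and> S \<subseteq> S' \<and> (half_optimal A S' \<or> card S < card S')"
        using half_optimal_of_infeasible[OF G best] fits s1(1) G by blast
    qed
  qed
  show ?thesis
    unfolding greedy_round_def
  proof (intro runs_Seq runs_mono[OF slack] runs_NAssign runs_mono[OF scan], goal_cases)
    case (3 s1 s2)
    then show ?case
      by (intro final) (auto simp: unchanged_def I_def)
  qed (auto simp: greedy_memory_def)
qed

text \<open>If no round reaches half-optimality, each of the \<open>n\<close> rounds adds an item;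
  the set is then the whole ground set and no candidate remains.\<close>

lemma runs_greedy:
  assumes "feasible A" "greedy_memory A A s"
  shows "runs f n (For 5 1 (greedy_round p)) s (\<lambda>s'. \<exists>S. greedy_memory A S s' \<and> extension A S \<and> half_optimal A S)"
proof -
  \<comment> \<open>Before round \<open>k\<close> only \<open>k - 1\<close> rounds are over, hence
    \<open>Suc (card S)\<close>.\<close>
  define I where "I = (\<lambda>k s'. \<exists>S. greedy_memory A S s' \<and> greedy_state A S \<and> (half_optimal A S \<or> k \<le> Suc (card S)))"
  have mem5: "greedy_memory A S (nwrite 5 0 x s') = greedy_memory A S s'" for S x s'
    by (simp add: greedy_memory_def)
  have "runs f n (For 5 1 (greedy_round p)) s (I (Suc n))"
  proof (rule runs_For)
    show "I 1 (nwrite 5 0 1 s)"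
      using assms greedy_state_init by (auto simp: I_def mem5)
    fix k s1 assume "I k s1"
    then obtain S where S: "greedy_memory A S s1" "greedy_state A S" "half_optimal A S \<or> k \<le> Suc (card S)"
      by (auto simp: I_def)
    show "runs f n (greedy_round p) s1 (\<lambda>s'. I (Suc k) (nwrite 5 0 (Suc k) s'))"
    proof (rule runs_mono[OF runs_greedy_round[OF S(2,1)]])
      fix s' assume "\<exists>S'. greedy_memory A S' s' \<and> greedy_state A S' \<and> S \<subseteq> S' \<and> (half_optimal A S' \<or> card S < card S')"
      then obtain S' where S': "greedy_memory A S' s'" "greedy_state A S'" "S \<subseteq> S'" "half_optimal A S' \<or> card S < card S'"
        by blast
      moreover have "S' \<subseteq> {1..n}"
        using S' by (auto simp: greedy_state_def extension_def feasible_iff)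
      ultimately show "I (Suc k) (nwrite 5 0 (Suc k) s')"
        using S(3) half_optimal_mono[of A S S'] unfolding I_def mem5 by (intro exI[of _ S']) auto
    qed
  qed (use assms in \<open>auto simp: greedy_memory_def input_def\<close>)
  then show ?thesis
  proof (rule runs_mono)
    fix s' assume "I (Suc n) s'"
    then obtain S where S: "greedy_memory A S s'" "greedy_state A S" "half_optimal A S \<or> n \<le> card S"
      by (auto simp: I_def)
    have ext: "extension A S"
      using S by (simp add: greedy_state_def)
    have "half_optimal A S" if "n \<le> card S"
    proof (rule half_optimal_of_no_candidates[OF ext])
      have "S = {1..n}"
        using that ext by (intro card_seteq) (auto simp: extension_def feasible_iff)
      then show "candidates A S = {}"
        by (auto simp: candidates_def)
    qed
    then show "\<exists>S. greedy_memory A S s' \<and> extension A S \<and> half_optimal A S"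
      using S ext by blast
  qed
qed

section \<open>Loading, evaluating and enumerating guesses\<close>

definition guess :: "nat \<Rightarrow> memory \<Rightarrow> nat set" where
  "guess m s = (\<lambda>k. fst s (guess_var k) 0) ` {1..m} \<inter> {1..n}"

definition improved :: "memory \<Rightarrow> memory \<Rightarrow> bool" where
  "improved s s' \<longleftrightarrow> input s' \<and> feasible (output_set n s') \<and> f (output_set n s) \<le> f (output_set n s')"

lemma runs_clear:
  assumes "input s"
  shows "runs f n (For 3 1 (NAssign 2 item (NConst 0))) s (\<lambda>s'. input s' \<and> stored_set n s' 2 = {})"
proof -
  have "runs f n (For 3 1 (NAssign 2 item (NConst 0))) s
     ((\<lambda>k s'. input s' \<and> stored_set n s' 2 \<inter> {1..<k} = {}) (Suc n))"
    using assms by (intro runs_For runs_NAssign) (auto simp: input_def stored_set_def less_Suc_eq)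
  then show ?thesis
    by (rule runs_mono) (auto simp: stored_set_def)
qed

lemma runs_copy:
  assumes "input s"
  shows "runs f n (For 3 1 (NAssign 1 item (NCell 2 item))) s
     (\<lambda>s'. input s' \<and> output_set n s' = stored_set n s 2)"
proof -
  have "runs f n (For 3 1 (NAssign 1 item (NCell 2 item))) s
     ((\<lambda>k s'. input s' \<and> fst s' 2 = fst s 2 \<and> (\<forall>j\<in>{1..<k}. fst s' 1 j = fst s 2 j)) (Suc n))"
    using assms by (intro runs_For runs_NAssign) (auto simp: input_def less_Suc_eq)
  then show ?thesis
    by (rule runs_mono) (auto simp: output_set_def stored_set_def)
qed

lemma runs_evaluate_guess:
  assumes "input s" "feasible (output_set n s)"
  shows "runs f n (evaluate_guess p m) s (\<lambda>s'. improved s s' \<and>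
     (feasible (guess m s) \<longrightarrow> half_optimal (guess m s) (output_set n s')))"
proof -
  let ?A = "guess m s"
  let ?load = "unroll (\<lambda>k. NAssign 2 (NCell (guess_var k) (NConst 0)) (NConst 1)) m"
  let ?ones = "unroll (\<lambda>i. RAssign (p + 1) (NConst i) (RConst 1)) p"
  have load: "runs f n ?load s1 (\<lambda>s'. stored_set n s' 2 = ?A)"
    if "stored_set n s1 2 = {}" "\<And>k. 1 \<le> k \<Longrightarrow> fst s1 (guess_var k) = fst s (guess_var k)" for s1
  proof -
    have "runs f n ?load s1 ((\<lambda>k s'. (\<forall>k\<ge>1. fst s' (guess_var k) = fst s (guess_var k)) \<and> stored_set n s' 2 = guess k s) m)"
    proof (rule runs_unroll)
      fix k s' assume *: "(\<forall>k\<ge>1. fst s' (guess_var k) = fst s (guess_var k)) \<and> stored_set n s' 2 = guess k s"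
      have "guess (Suc k) s = insert (fst s (guess_var (Suc k)) 0) (guess k s) \<inter> {1..n}"
        by (auto simp: guess_def atLeastAtMostSuc_conv)
      moreover have "guess k s \<subseteq> {1..n}"
        by (auto simp: guess_def)
      moreover have "fst s' (guess_var (Suc k)) = fst s (guess_var (Suc k))"
        using conjunct1[OF *] by (metis le_add1 plus_1_eq_Suc)
      ultimately show "runs f n (NAssign 2 (NCell (guess_var (Suc k)) (NConst 0)) (NConst 1)) s'
         (\<lambda>s'. (\<forall>k\<ge>1. fst s' (guess_var k) = fst s (guess_var k)) \<and> stored_set n s' 2 = guess (Suc k) s)"
        using * by (intro runs_NAssign) auto
    qed (use that in \<open>auto simp: guess_def\<close>)
    then show ?thesis
      by (rule runs_mono) simp
  qed
  have ones: "runs f n ?ones s1 (\<lambda>s'. \<forall>i\<in>{1..p}. snd s' (p + 1) i = 1)" for s1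
    by (rule runs_unroll[where I = "\<lambda>k s'. \<forall>i\<in>{1..k}. snd s' (p + 1) i = 1"])
      (auto intro!: runs_RAssign simp: less_Suc_eq_le le_Suc_eq)
  let ?feas = "conj_bexp (\<lambda>i. RLe (RConst 0) (slack_cell p i)) p"
  let ?update = "Cond (RLe (Query 1) (Query 2)) (For 3 1 (NAssign 1 item (NCell 2 item))) Skip"
  have search: "runs f n (Cond ?feas (Seq (For 5 1 (greedy_round p)) ?update) Skip) s1
     (\<lambda>s'. improved s s' \<and> (feasible ?A \<longrightarrow> half_optimal ?A (output_set n s')))"
    if s1: "greedy_memory ?A ?A s1" "output_set n s1 = output_set n s" for s1
  proof (rule runs_Cond)
    have "bval f n s1 ?feas \<longleftrightarrow> feasible ?A"
      using s1 by (auto simp: feasible_iff greedy_memory_def guess_def)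
    moreover assume "\<not> bval f n s1 ?feas"
    ultimately show "runs f n Skip s1 (\<lambda>s'. improved s s' \<and> (feasible ?A \<longrightarrow> half_optimal ?A (output_set n s')))"
      using s1 assms by (intro runs_Skip) (auto simp: improved_def greedy_memory_def)
  next
    assume "bval f n s1 ?feas"
    then have feas: "feasible ?A"
      using s1 by (auto simp: feasible_iff greedy_memory_def guess_def)
    show "runs f n (Seq (For 5 1 (greedy_round p)) ?update) s1
        (\<lambda>s'. improved s s' \<and> (feasible ?A \<longrightarrow> half_optimal ?A (output_set n s')))"
    proof (intro runs_Seq runs_mono[OF runs_greedy[OF feas s1(1)]])
      fix s2 assume unch: "unchanged (For 5 1 (greedy_round p)) s1 s2"
        and "\<exists>S. greedy_memory ?A S s2 \<and> extension ?A S \<and> half_optimal ?A S"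
      then obtain S where S: "greedy_memory ?A S s2" "extension ?A S" "half_optimal ?A S"
        by blast
      have out: "output_set n s2 = output_set n s"
        using unch s1 by (auto simp: unchanged_def output_set_def stored_set_def)
      have inp: "input s2" "stored_set n s2 2 = S" "feasible S"
        using S by (auto simp: greedy_memory_def extension_def)
      \<comment> \<open>Whether or not \<open>S\<close> is copied, the output ends with value at
        least \<open>f S\<close>, and half-optimality depends on the value only.\<close>
      show "runs f n ?update s2 (\<lambda>s'. improved s s' \<and> (feasible ?A \<longrightarrow> half_optimal ?A (output_set n s')))"
        using out[unfolded output_set_def[of n s2]] out inp S assms
        by (intro runs_Cond runs_Skip runs_mono[OF runs_copy])
           (force simp: improved_def half_optimal_def)+
    qed
  qed
  show ?thesis
    unfolding evaluate_guess_def
  proof (intro runs_Seq runs_mono[OF runs_clear] runs_mono[OF load] runs_mono[OF runs_compute_slack] runs_mono[OF ones], goal_cases)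
    case (4 s1 s2)
    then have "input s1" "unchanged ?load s1 s2"
      by auto
    then show ?case
      by (rule input_unchanged) auto
  next
    case (6 s1 s2 s3 s4)
    then have "input s3" "unchanged ?ones s3 s4"
      by auto
    then have "input s4"
      by (rule input_unchanged) auto
    moreover have "stored_set n s4 2 = ?A" "output_set n s4 = output_set n s"
      using 6 by (simp_all add: unchanged_def stored_set_def output_set_def)
    ultimately show ?case
      using 6 by (intro search) (auto simp: greedy_memory_def weight_def unchanged_def)
  qed (use assms in \<open>auto simp: unchanged_def\<close>)
qed

text \<open>\<open>g\<close> is the target guess. If the outer variables agree with it, the inner
  loops hit the remaining values at some point, and from then on the output value cannot drop. In
  all other iterations \<open>improved\<close> is enough.\<close>

lemma runs_enumerate_guesses:
  assumes "\<And>k. g k \<le> n" "k \<le> m" "input s" "feasible (output_set n s)"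
    and feas: "feasible (g ` {1..m} \<inter> {1..n})"
  shows "runs f n (enumerate_guesses p m k) s (\<lambda>s'. improved s s' \<and>
     ((\<forall>l\<in>{k<..m}. fst s (guess_var l) 0 = g l) \<longrightarrow> half_optimal (g ` {1..m} \<inter> {1..n}) (output_set n s')))"
  using assms(2-4)
proof (induction k arbitrary: s)
  case 0
  have "guess m s = g ` {1..m} \<inter> {1..n}" if "\<forall>l\<in>{0<..m}. fst s (guess_var l) 0 = g l"
    unfolding guess_def by (intro arg_cong2[where f = "(\<inter>)"] image_cong) (use that in auto)
  then show ?case
    using feas by (auto intro!: runs_mono[OF runs_evaluate_guess[OF 0(2,3)]])
next
  case (Suc k)
  let ?A = "g ` {1..m} \<inter> {1..n}"
  let ?v = "guess_var (Suc k)"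
  \<comment> \<open>\<open>g (Suc k) < x\<close> says that this loop has passed the target value; on
    exit this holds as \<open>g\<close> is bounded by \<open>n\<close>.\<close>
  define I where "I = (\<lambda>x s'. improved s s' \<and> (\<forall>l\<in>{Suc k<..m}. fst s' (guess_var l) = fst s (guess_var l)) \<and>
     ((\<forall>l\<in>{Suc k<..m}. fst s (guess_var l) 0 = g l) \<and> g (Suc k) < x \<longrightarrow> half_optimal ?A (output_set n s')))"
  have "runs f n (enumerate_guesses p m (Suc k)) s (I (Suc n))"
    unfolding enumerate_guesses.simps
  proof (rule runs_For)
    show "I 0 (nwrite ?v 0 0 s)"
      using Suc.prems by (auto simp: I_def improved_def)
    fix x s1 assume x: "x \<le> n" "fst s1 ?v 0 = x" "I x s1"
    then have s1: "input s1" "feasible (output_set n s1)"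
      by (auto simp: I_def improved_def)
    show "runs f n (enumerate_guesses p m k) s1 (\<lambda>s'. I (Suc x) (nwrite ?v 0 (Suc x) s'))"
    proof (rule runs_mono[OF Suc.IH[OF _ s1]])
      show "k \<le> m"
        using Suc.prems by simp
      fix s2 assume unch: "unchanged (enumerate_guesses p m k) s1 s2"
        and s2: "improved s1 s2 \<and> ((\<forall>l\<in>{k<..m}. fst s1 (guess_var l) 0 = g l) \<longrightarrow> half_optimal ?A (output_set n s2))"
      have sub: "output_set n s2 \<subseteq> {1..n}"
        unfolding output_set_def by (rule stored_set_subset)
      have "half_optimal ?A (output_set n s2)"
        if match: "\<forall>l\<in>{Suc k<..m}. fst s (guess_var l) 0 = g l" and less: "g (Suc k) < Suc x"
      proof (cases "g (Suc k) = x")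
        case True
        have "fst s1 (guess_var l) 0 = g l" if "l \<in> {k<..m}" for l
          using that match x True by (cases "l = Suc k") (auto simp: I_def)
        then show ?thesis
          using s2 by blast
      next
        case False
        then have "half_optimal ?A (output_set n s1)"
          using x match less by (auto simp: I_def)
        then show ?thesis
          using s2 by (fastforce simp: half_optimal_def improved_def)
      qed
      moreover have "fst s2 (guess_var l) = fst s (guess_var l)" if "l \<in> {Suc k<..m}" for l
        using that unch x by (auto simp: unchanged_def nmod_enumerate_guesses I_def)
      ultimately show "I (Suc x) (nwrite ?v 0 (Suc x) s2)"
        using x s2 by (auto simp: I_def improved_def)
    qed
  qed (use Suc.prems in \<open>auto simp: input_def nmod_enumerate_guesses\<close>)
  then show ?case
    by (rule runs_mono) (use assms(1) in \<open>auto simp: I_def less_Suc_eq_le\<close>)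
qed

lemma runs_algorithm:
  assumes m: "m = 512 * (p + 1) ^ 2" and opt: "feasible Opt"
  shows "runs f n (enumerate_guesses p m m) (initial_memory p n P)
     (\<lambda>s'. feasible (output_set n s') \<and> 7 / 16 * f Opt \<le> f (output_set n s'))"
proof -
  obtain A T where A: "A \<subseteq> {1..n}" "card A \<le> m" "extension A T" "7 / 8 * f Opt \<le> f T"
    using exists_extension[OF opt] m by auto
  obtain xs where xs: "set xs = A" "length xs = card A"
    using A(1) finite_subset[of A "{1..n}"] by (metis distinct_card finite_atLeastAtMost finite_distinct_list)
  define g where "g = (\<lambda>k. if 1 \<le> k \<and> k \<le> length xs then xs ! (k - 1) else 0)"
  have "g k \<in> insert 0 A" for k
    using xs(1) nth_mem[of "k - 1" xs] by (auto simp: g_def)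
  then have "g k \<le> n" for k
    using A(1) by (metis atLeastAtMost_iff insert_iff le0 subset_iff)
  moreover have "g ` {1..m} \<inter> {1..n} = A"
  proof (intro equalityI subsetI)
    fix x assume "x \<in> g ` {1..m} \<inter> {1..n}"
    then show "x \<in> A"
      using xs by (auto simp: g_def split: if_splits)
  next
    fix x assume "x \<in> A"
    then obtain i where "i < length xs" "x = xs ! i"
      using xs by (metis in_set_conv_nth)
    then have "x = g (Suc i)" "Suc i \<in> {1..m}"
      using xs A(2) by (auto simp: g_def)
    then show "x \<in> g ` {1..m} \<inter> {1..n}"
      using A(1) \<open>x \<in> A\<close> by blast
  qed
  moreover have "input (initial_memory p n P)" "output_set n (initial_memory p n P) = {}"
    by (auto simp: input_def initial_memory_def output_set_def stored_set_def)
  moreover have "feasible {}"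
    by (simp add: packing_feasible_iff)
  ultimately have "runs f n (enumerate_guesses p m m) (initial_memory p n P) (\<lambda>s'.
      improved (initial_memory p n P) s' \<and> half_optimal A (output_set n s'))"
    using runs_enumerate_guesses[of g m m "initial_memory p n P"] extension_feasible[OF A(3)] by simp
  then show ?thesis
    by (rule runs_mono) (use A in \<open>force simp: improved_def half_optimal_def\<close>)
qed

end

section \<open>Comparison with 1 / e, and the running time\<close>

lemma inverse_e_less: "1 / exp 1 < (7 / 16 :: real)"
proof -
  have "1 + 1 + 1\<^sup>2 / 2 \<le> exp (1 :: real)"
    by (rule exp_lower_Taylor_quadratic) simp
  then show ?thesis
    by (simp add: field_simps)
qed

lemma packing_approx_algorithm_enumerate_guesses:
  assumes "0 < \<epsilon>" and m: "m = 512 * (p + 1) ^ 2"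
  shows "packing_approx_algorithm p (1 / exp 1 - \<epsilon>) (\<lambda>n. cost n (enumerate_guesses p m m)) (enumerate_guesses p m m)"
  unfolding packing_approx_algorithm_def
proof (intro allI impI)
  let ?c = "enumerate_guesses p m m"
  fix n f P
  assume "nonneg_on {1..n} f \<and> monotone_set_fun {1..n} f \<and> submodular {1..n} f \<and> nonneg_matrix p n P"
  then interpret packing_instance n p f P
    by unfold_locales auto
  have runs: "\<exists>t s. exec f n ?c (initial_memory p n P) t s \<and> t \<le> cost n ?c \<and>
      feasible (output_set n s) \<and> 7 / 16 * f Opt \<le> f (output_set n s)" if "feasible Opt" for Opt
    using runs_algorithm[OF m that] unfolding runs_def by blast
  have "feasible {}"
    by (simp add: packing_feasible_iff)
  then obtain t s where ts: "exec f n ?c (initial_memory p n P) t s" "t \<le> cost n ?c" "feasible (output_set n s)"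
    using runs by blast
  have "(1 / exp 1 - \<epsilon>) * f Opt \<le> f (output_set n s)" if "packing_optimal p n P f Opt" for Opt
  proof -
    have opt: "feasible Opt"
      using that by (simp add: packing_optimal_def)
    have "(1 / exp 1 - \<epsilon>) * f Opt \<le> 7 / 16 * f Opt"
      using inverse_e_less assms(1) opt by (intro mult_right_mono f_nonneg) (auto simp: feasible_iff)
    also have "\<dots> \<le> f (output_set n s)"
      \<comment> \<open>The run named above stems from the empty competitor; by determinism the run
        obtained for \<open>Opt\<close> ends in the same memory.\<close>
      using runs[OF opt] exec_deterministic[OF ts(1)] by blast
    finally show ?thesis .
  qed
  then show "\<exists>t s. exec f n ?c (initial_memory p n P) t s \<and> t \<le> cost n ?c \<and>
      packing_feasible p n P (output_set n s) \<and>
      (\<forall>Opt. packing_optimal p n P f Opt \<longrightarrow> (1 / exp 1 - \<epsilon>) * f Opt \<le> f (output_set n s))"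
    using ts by blast
qed

theorem theorem4:
  fixes p :: nat
  shows "\<exists>q :: real poly. \<forall>\<epsilon> :: real. \<epsilon> > 0 \<longrightarrow>
    (\<exists>c T. packing_approx_algorithm p (1 / exp 1 - \<epsilon>) T c
        \<and> (\<lambda>n. real (T n)) \<in> O(\<lambda>n. real n powr poly q (1 / \<epsilon>)))"
proof (intro exI allI impI conjI)
  let ?m = "512 * (p + 1) ^ 2"
  let ?c = "enumerate_guesses p ?m ?m"
  fix \<epsilon> :: real assume "0 < \<epsilon>"
  then show "packing_approx_algorithm p (1 / exp 1 - \<epsilon>) (\<lambda>n. cost n ?c) ?c"
    by (rule packing_approx_algorithm_enumerate_guesses) simp
  \<comment> \<open>The loop depth involves \<open>p\<close> but not \<epsilon>, so one constant
    polynomial serves for every \<epsilon>.\<close>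
  show "(\<lambda>n. real (cost n ?c)) \<in> O(\<lambda>n. real n powr poly [:real (loop_depth ?c):] (1 / \<epsilon>))"
    using cost_bigo by simp
qed

end
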